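(* Let $T>0$ and let $h,b\colon\mathbb{R}\to\mathbb{R}$ satisfy (A1) and (A2). If $p\in L^{4}(0,T;L^2(0,1))$ and $v_0\in L^2(0,1)$, then the problem (P)($p,v_0$) has at most one weak solution.
   Context: Put $Q(T)=(0,T)\times(0,1)$, $H=L^2(0,1)$, $X=H^1(0,1)$. Assumption (A1): $h\in C^2(\mathbb{R})$ with $\delta_h\le h'\le C_h$ and $|h''|\le C_h$ on $\mathbb{R}$, for positive constants $\delta_h,C_h$. Assumption (A2): $b\in C^2(\mathbb{R})$ with $\delta_b\le b\le C_b$ and $|b'|,|b''|\le C_b$ on $\mathbb{R}$, for positive constants $\delta_b,C_b$. The problem (P)($p,v_0$) is $\partial_t h(v)=\partial_x(\partial_x v+b(v)p)$ in $Q(T)$, $\partial_x v+b(v)p=0$ at $x=0,1$ for $0<t<T$, $v(0,x)=v_0(x)$ for $x\in(0,1)$, where $p\colon(0,T)\times[0,1]\to\mathbb{R}$ is given. A weak solution of (P)($p,v_0$) is a function $v\colon[0,T)\times(0,1)\to\mathbb{R}$ with $v\in L^\infty(0,T;H)\cap L^2(0,T;X)$ such that $$-\int_{Q(T)}h(v)\,\partial_t\eta\,dx\,dt+\int_{Q(T)}(\partial_x v+b(v)p)\,\partial_x\eta\,dx\,dt=\int_0^1 h(v_0(x))\eta(0,x)\,dx$$ for every $\eta\in W^{1,2}(0,T;H)\cap L^2(0,T;X)$ with $\eta(T,\cdot)=0$. *)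

theory Defs
  imports "HOL-Analysis.Analysis"
begin

text \<open>Space-time functions are written u t x, with t the time and x the space variable.\<close>

definition Qset :: "real \<Rightarrow> (real \<times> real) set" where
  "Qset T = {0<..<T} \<times> {0<..<1}"

definition unc :: "(real \<Rightarrow> real \<Rightarrow> real) \<Rightarrow> real \<times> real \<Rightarrow> real" where
  "unc u = (\<lambda>z. u (fst z) (snd z))"

definition C2_fun :: "(real \<Rightarrow> real) \<Rightarrow> bool" where
  "C2_fun f \<longleftrightarrow> (\<forall>x. f differentiable (at x)) \<and> (\<forall>x. deriv f differentiable (at x))
      \<and> continuous_on UNIV (deriv (deriv f))"

definition assm_A1 :: "(real \<Rightarrow> real) \<Rightarrow> bool" where
  "assm_A1 h \<longleftrightarrow> C2_fun h \<and> (\<exists>\<delta> C. \<delta> > 0 \<and> C > 0 \<and>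
      (\<forall>x. \<delta> \<le> deriv h x \<and> deriv h x \<le> C \<and> \<bar>deriv (deriv h) x\<bar> \<le> C))"

definition assm_A2 :: "(real \<Rightarrow> real) \<Rightarrow> bool" where
  "assm_A2 b \<longleftrightarrow> C2_fun b \<and> (\<exists>\<delta> C. \<delta> > 0 \<and> C > 0 \<and>
      (\<forall>x. \<delta> \<le> b x \<and> b x \<le> C \<and> \<bar>deriv b x\<bar> \<le> C \<and> \<bar>deriv (deriv b) x\<bar> \<le> C))"

definition test_fun :: "real \<Rightarrow> real \<Rightarrow> (real \<Rightarrow> real) \<Rightarrow> bool" where
  "test_fun a b \<phi> \<longleftrightarrow> (\<forall>n x. ((deriv ^^ n) \<phi>) differentiable (at x)) \<and>
      (\<exists>c d. a < c \<and> d < b \<and> (\<forall>x. x \<notin> {c..d} \<longrightarrow> \<phi> x = 0))"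

definition L2_int :: "real \<Rightarrow> real \<Rightarrow> (real \<Rightarrow> real) \<Rightarrow> bool" where
  "L2_int a b f \<longleftrightarrow> set_borel_measurable lebesgue {a<..<b} f \<and>
      set_integrable lebesgue {a<..<b} (\<lambda>x. (f x)\<^sup>2)"

definition weak_deriv_on :: "real \<Rightarrow> real \<Rightarrow> (real \<Rightarrow> real) \<Rightarrow> (real \<Rightarrow> real) \<Rightarrow> bool" where
  "weak_deriv_on a b f g \<longleftrightarrow> set_integrable lebesgue {a<..<b} f \<and> set_integrable lebesgue {a<..<b} g \<and>
      (\<forall>\<phi>. test_fun a b \<phi> \<longrightarrow>
        (LINT x:{a<..<b}|lebesgue. f x * deriv \<phi> x) = - (LINT x:{a<..<b}|lebesgue. g x * \<phi> x))"

text \<open>L^2(0,T;H) = L^2(Q(T)).\<close>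
definition L2_Q :: "real \<Rightarrow> (real \<Rightarrow> real \<Rightarrow> real) \<Rightarrow> bool" where
  "L2_Q T u \<longleftrightarrow> set_borel_measurable lebesgue (Qset T) (unc u) \<and>
      set_integrable lebesgue (Qset T) (\<lambda>z. (unc u z)\<^sup>2)"

definition Linf_H :: "real \<Rightarrow> (real \<Rightarrow> real \<Rightarrow> real) \<Rightarrow> bool" where
  "Linf_H T u \<longleftrightarrow> set_borel_measurable lebesgue (Qset T) (unc u) \<and>
      (\<exists>C. AE t in lebesgue. t \<in> {0<..<T} \<longrightarrow>
          L2_int 0 1 (u t) \<and> (LINT x:{0<..<1}|lebesgue. (u t x)\<^sup>2) \<le> C)"

definition L4_H :: "real \<Rightarrow> (real \<Rightarrow> real \<Rightarrow> real) \<Rightarrow> bool" where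
  "L4_H T u \<longleftrightarrow> set_borel_measurable lebesgue (Qset T) (unc u) \<and>
      (AE t in lebesgue. t \<in> {0<..<T} \<longrightarrow> L2_int 0 1 (u t)) \<and>
      set_integrable lebesgue {0<..<T} (\<lambda>t. (LINT x:{0<..<1}|lebesgue. (u t x)\<^sup>2)\<^sup>2)"

definition L2_X_with :: "real \<Rightarrow> (real \<Rightarrow> real \<Rightarrow> real) \<Rightarrow> (real \<Rightarrow> real \<Rightarrow> real) \<Rightarrow> bool" where
  "L2_X_with T u ux \<longleftrightarrow> L2_Q T u \<and> L2_Q T ux \<and>
      (AE t in lebesgue. t \<in> {0<..<T} \<longrightarrow> weak_deriv_on 0 1 (u t) (ux t))"

text \<open>u in W^{1,2}(0,T;H) with weak time derivative ut in L^2(0,T;H)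
  (the H-valued identity is tested against every element psi of H).\<close>
definition W12_H_with :: "real \<Rightarrow> (real \<Rightarrow> real \<Rightarrow> real) \<Rightarrow> (real \<Rightarrow> real \<Rightarrow> real) \<Rightarrow> bool" where
  "W12_H_with T u ut \<longleftrightarrow> L2_Q T u \<and> L2_Q T ut \<and>
      (\<forall>\<phi> \<psi>. test_fun 0 T \<phi> \<longrightarrow> L2_int 0 1 \<psi> \<longrightarrow>
         (LINT z:Qset T|lebesgue. unc u z * deriv \<phi> (fst z) * \<psi> (snd z))
         = - (LINT z:Qset T|lebesgue. unc ut z * \<phi> (fst z) * \<psi> (snd z)))"

text \<open>The representative u is continuous from [0,T] into H (so that traces u(0), u(T) make sense).\<close>
definition cont_H :: "real \<Rightarrow> (real \<Rightarrow> real \<Rightarrow> real) \<Rightarrow> bool" where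
  "cont_H T u \<longleftrightarrow> (\<forall>t\<in>{0..T}. L2_int 0 1 (u t)) \<and>
      (\<forall>t\<in>{0..T}. ((\<lambda>s. LINT x:{0<..<1}|lebesgue. (u s x - u t x)\<^sup>2) \<longlongrightarrow> 0) (at t within {0..T}))"

definition weak_solution ::
  "(real \<Rightarrow> real) \<Rightarrow> (real \<Rightarrow> real) \<Rightarrow> real \<Rightarrow> (real \<Rightarrow> real \<Rightarrow> real) \<Rightarrow> (real \<Rightarrow> real)
   \<Rightarrow> (real \<Rightarrow> real \<Rightarrow> real) \<Rightarrow> bool" where
  "weak_solution h b T p v0 v \<longleftrightarrow> Linf_H T v \<and>
     (\<exists>vx. L2_X_with T v vx \<and>
       (\<forall>\<eta> \<eta>x \<eta>t. W12_H_with T \<eta> \<eta>t \<and> L2_X_with T \<eta> \<eta>x \<and> cont_H T \<eta> \<and>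
           (AE x in lebesgue. x \<in> {0<..<1} \<longrightarrow> \<eta> T x = 0) \<longrightarrow>
          - (LINT z:Qset T|lebesgue. h (unc v z) * unc \<eta>t z)
          + (LINT z:Qset T|lebesgue. (unc vx z + b (unc v z) * unc p z) * unc \<eta>x z)
          = (LINT x:{0<..<1}|lebesgue. h (v0 x) * \<eta> 0 x)))"

end

theory Submission
  imports Defs
begin

text \<open>
  Let V = v1 - v2, w = h(v1) - h(v2), R = (b(v1) - b(v2)) p and F = V_x + R, the difference of the
  two fluxes, so that formally w_t = F_x with F = 0 at x = 0, 1. Testing with the time primitives
  \<integral>_t^T \<theta> turns the weak equation into \<integral> w \<theta> + \<integral> G \<theta>_x = 0 for all \<theta> in L^2(0,T;X), where
  G(t) = \<integral>_0^t F. Two choices of \<theta> suffice. Space primitives show that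
  G(t,y) = - \<integral>_y^1 w(t), hence sup G(t)^2 \<le> 2 |G(t)| |w(t)| with L^2(0,1) norms; \<theta> = V on (0,\<tau>)
  gives the energy identity \<integral>_0^\<tau> \<integral> w V + |G(\<tau>)|^2 / 2 = \<integral>_0^\<tau> \<integral> R G. The monotonicity of h and
  Young's inequality bound |G(\<tau>)|^2 by a multiple of \<integral>_0^\<tau> |p|^4 |G|^2, and Gronwall's lemma
  gives G = 0, so that \<integral> w V = 0 and V = 0.
\<close>

text \<open>V itself is no admissible test function, since nothing is known about its time
  derivative; a time primitive is admissible and vanishes at T. The initial data enter both
  equations in the same way and cancel. Formally G is a potential: its time derivative is F, its
  space derivative is w, and it vanishes at both ends. The obstacle is the product R G: for fixed t
  the factors V and p are only in L^2(0,1), so G must be bounded uniformly in x. Since |w| \<le> C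
  |V|, the bound on sup G^2 gives \<integral> |R G| \<le> C |V|^(3/2) |p| |G|^(1/2), and Young's
  inequality with exponents 4/3 and 4 leaves a small multiple of |V|^2 and C |p|^4 |G|^2. This is
  the origin of the exponent 4 in the assumption on p. Fractional powers never appear below: two
  quadratic Young inequalities, one with a free parameter, have the same effect.\<close>

section \<open>Lebesgue measure on a Borel set\<close>

text \<open>
  A density instead of a restricted space: all measurability obligations then refer to the plain
  Borel algebra, and products of these measures are again of this form.
\<close>
definition leb_on :: "'a::euclidean_space set \<Rightarrow> 'a measure" where
  "leb_on S = density lborel (\<lambda>x. ennreal (indicator S x))"

lemma sets_leb_on [simp, measurable_cong]: "sets (leb_on S) = sets borel"
  by (simp add: leb_on_def)

lemma space_leb_on [simp]: "space (leb_on S) = UNIV"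
  by (simp add: leb_on_def)

lemma measurable_leb_on [simp]: "measurable (leb_on S) N = measurable borel N"
  by (intro measurable_cong_sets) auto

lemma AE_leb_on:
  assumes [measurable]: "S \<in> sets borel"
  shows "(AE x in leb_on S. P x) \<longleftrightarrow> (AE x in lebesgue. x \<in> S \<longrightarrow> P x)"
proof -
  have "(AE x in leb_on S. P x) \<longleftrightarrow> (AE x in lborel. 0 < ennreal (indicator S x) \<longrightarrow> P x)"
    unfolding leb_on_def by (subst AE_density) auto
  also have "\<dots> \<longleftrightarrow> (AE x in lborel. x \<in> S \<longrightarrow> P x)"
    by (intro AE_cong) (auto simp: indicator_def)
  finally show ?thesis by (simp add: AE_completion_iff)
qed

lemma AE_leb_on_mem: "S \<in> sets borel \<Longrightarrow> AE x in leb_on S. x \<in> S"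
  by (simp add: AE_leb_on)

lemma AE_leb_on_interval: "AE x in leb_on {a<..<b::real}. x \<in> {a<..<b}"
  by (rule AE_leb_on_mem) simp

text \<open>A function that agrees almost everywhere with a Borel function is measurable for the
  completed measure, so \<open>f\<close> comes without a measurability hypothesis. These rules carry
  the set integrals of the definitions over to \<open>leb_on\<close>.\<close>

lemma leb_on_transfer:
  fixes f g :: "'a::euclidean_space \<Rightarrow> real"
  assumes [measurable]: "S \<in> sets borel" "g \<in> borel_measurable borel"
    and eq: "AE x in leb_on S. f x = g x"
  shows set_integrable_leb_on: "set_integrable lebesgue S f \<longleftrightarrow> integrable (leb_on S) g"
    and set_lebesgue_integral_leb_on: "(LINT x:S|lebesgue. f x) = (\<integral>x. g x \<partial>leb_on S)"
    and set_borel_measurable_leb_on: "set_borel_measurable lebesgue S f"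
proof -
  have ae: "AE x in lebesgue. indicat_real S x *\<^sub>R g x = indicat_real S x *\<^sub>R f x"
    using eq unfolding AE_leb_on[OF assms(1)] by eventually_elim (auto simp: indicator_def)
  have g: "(\<lambda>x. indicat_real S x *\<^sub>R g x) \<in> borel_measurable lborel" by measurable
  then have g': "(\<lambda>x. indicat_real S x *\<^sub>R g x) \<in> borel_measurable lebesgue"
    by (rule measurable_completion)
  have f': "(\<lambda>x. indicat_real S x *\<^sub>R f x) \<in> borel_measurable lebesgue"
    by (rule borel_measurable_AE[OF g' ae])
  then show "set_borel_measurable lebesgue S f" by (simp add: set_borel_measurable_def)
  have "set_integrable lebesgue S f \<longleftrightarrow> integrable lebesgue (\<lambda>x. indicat_real S x *\<^sub>R g x)"
    unfolding set_integrable_def using ae by (intro integrable_cong_AE f' g') (auto elim: eventually_mono)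
  also have "\<dots> \<longleftrightarrow> integrable (leb_on S) g"
    unfolding leb_on_def by (subst integrable_density) (auto simp: integrable_completion)
  finally show "set_integrable lebesgue S f \<longleftrightarrow> integrable (leb_on S) g" .
  have "(LINT x:S|lebesgue. f x) = (\<integral>x. indicat_real S x *\<^sub>R g x \<partial>lebesgue)"
    unfolding set_lebesgue_integral_def using ae by (intro integral_cong_AE f' g') (auto elim: eventually_mono)
  also have "\<dots> = (\<integral>x. g x \<partial>leb_on S)"
    unfolding leb_on_def by (subst integral_density) (auto simp: integral_completion)
  finally show "(LINT x:S|lebesgue. f x) = (\<integral>x. g x \<partial>leb_on S)" .
qed

text \<open>Sections of a Lebesgue measurable function of two variables need not be measurable.
  Passing to Borel representatives makes the later use of Fubini's theorem and of time slices
  legitimate.\<close>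

lemma leb_on_borel_rep:
  fixes f :: "'a::euclidean_space \<Rightarrow> real"
  assumes [measurable]: "S \<in> sets borel" and "set_borel_measurable lebesgue S f"
  obtains g where "g \<in> borel_measurable borel" "AE x in leb_on S. f x = g x"
proof -
  obtain g where g: "g \<in> borel_measurable lborel" "AE x in lborel. indicat_real S x *\<^sub>R f x = g x"
    using completion_ex_borel_measurable_real assms(2) unfolding set_borel_measurable_def by blast
  have "AE x in lebesgue. indicat_real S x *\<^sub>R f x = g x" using g(2) by (rule AE_completion)
  then have "AE x in leb_on S. f x = g x"
    unfolding AE_leb_on[OF assms(1)] by eventually_elim (auto simp: indicator_def)
  with g(1) show ?thesis by (intro that[of g]) auto
qed

lemma Qset_borel [measurable, simp]: "Qset T \<in> sets borel"
  unfolding Qset_def by (intro borel_open open_Times) auto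

lemma finite_measure_leb_on_interval: "finite_measure (leb_on {a<..<b::real})"
  by (intro finite_measureI) (cases "a \<le> b"; simp add: leb_on_def emeasure_density ennreal_indicator)

text \<open>Each side has its use: the product allows Fubini and slicing, while the single density
  on \<open>Qset T\<close> is what the set integrals in the definition of a weak solution transfer
  to.\<close>

lemma leb_on_Qset: "leb_on {0<..<T} \<Otimes>\<^sub>M leb_on {0<..<1} = leb_on (Qset T)"
proof -
  have "sigma_finite_measure (leb_on {0<..<1::real})"
    using finite_measure_leb_on_interval by (rule finite_measure.axioms)
  then have "leb_on {0<..<T} \<Otimes>\<^sub>M leb_on {0<..<1::real} = density (lborel \<Otimes>\<^sub>M lborel)
      (\<lambda>(x,y). ennreal (indicator {0<..<T} x) * ennreal (indicator {0<..<1::real} y))"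
    unfolding leb_on_def
    by (intro pair_measure_density) (auto intro: lborel.sigma_finite_measure_axioms)
  also have "\<dots> = leb_on (Qset T)"
    unfolding leb_on_def lborel_prod
  proof (intro density_cong)
    show "(\<lambda>(x, y). ennreal (indicator {0<..<T} x) * ennreal (indicator {0<..<1::real} y)) \<in> borel_measurable lborel"
      by (simp add: borel_prod[symmetric] case_prod_beta')
  qed (simp, auto simp: Qset_def indicator_def)
  finally show ?thesis .
qed

lemma measure_leb_on_le:
  assumes "s \<le> t"
  shows "measure (leb_on {a<..<b::real}) {s<..t} \<le> t - s"
proof -
  have "emeasure (leb_on {a<..<b}) {s<..t} = (\<integral>\<^sup>+x. indicator {a<..<b} x * indicator {s<..t} x \<partial>lborel)"
    by (simp add: leb_on_def emeasure_density ennreal_indicator)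
  also have "\<dots> \<le> (\<integral>\<^sup>+x. indicator {s<..t} x \<partial>lborel)"
    by (intro nn_integral_mono) (auto simp: indicator_def)
  also have "\<dots> = ennreal (t - s)" using assms by simp
  finally have "emeasure (leb_on {a<..<b}) {s<..t} \<le> ennreal (t - s)" .
  then show ?thesis using assms by (simp add: measure_def enn2real_leI)
qed

section \<open>Square-integrable functions and triangular integrals\<close>

definition L2fun :: "'a measure \<Rightarrow> ('a \<Rightarrow> real) \<Rightarrow> bool" where
  "L2fun M f \<longleftrightarrow> f \<in> borel_measurable M \<and> integrable M (\<lambda>x. (f x)\<^sup>2)"

lemma L2fun_measurable: "L2fun M f \<Longrightarrow> f \<in> borel_measurable M"
  and L2fun_square: "L2fun M f \<Longrightarrow> integrable M (\<lambda>x. (f x)\<^sup>2)"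
  by (auto simp: L2fun_def)

lemma abs_mult_le_squares: "\<bar>a * b\<bar> \<le> a\<^sup>2 + (b::real)\<^sup>2"
proof -
  have "0 \<le> (\<bar>a\<bar> - \<bar>b\<bar>)\<^sup>2" by simp
  then have "2 * \<bar>a * b\<bar> \<le> a\<^sup>2 + b\<^sup>2" by (simp add: power2_diff abs_mult)
  then show ?thesis using abs_ge_zero[of "a * b"] by linarith
qed

lemma L2fun_mult_integrable:
  assumes "L2fun M f" "L2fun M g"
  shows "integrable M (\<lambda>x. f x * g x)"
proof (rule Bochner_Integration.integrable_bound)
  show "integrable M (\<lambda>x. (f x)\<^sup>2 + (g x)\<^sup>2)" using assms by (auto simp: L2fun_def)
  show "(\<lambda>x. f x * g x) \<in> borel_measurable M" using assms by (auto simp: L2fun_def)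
  show "AE x in M. norm (f x * g x) \<le> norm ((f x)\<^sup>2 + (g x)\<^sup>2)"
    using abs_mult_le_squares by (auto intro: order_trans)
qed

lemma L2fun_bound:
  assumes "L2fun M f" "g \<in> borel_measurable M" "AE x in M. \<bar>g x\<bar> \<le> C * \<bar>f x\<bar>"
  shows "L2fun M g"
  unfolding L2fun_def
proof
  show "integrable M (\<lambda>x. (g x)\<^sup>2)"
  proof (rule Bochner_Integration.integrable_bound)
    show "integrable M (\<lambda>x. C\<^sup>2 * (f x)\<^sup>2)" using assms(1) by (auto simp: L2fun_def)
    show "AE x in M. norm ((g x)\<^sup>2) \<le> norm (C\<^sup>2 * (f x)\<^sup>2)"
      using assms(3)
    proof eventually_elim
      case (elim x)
      then have "\<bar>g x\<bar>\<^sup>2 \<le> (C * \<bar>f x\<bar>)\<^sup>2" by (intro power_mono) auto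
      then show ?case by (simp add: power_mult_distrib)
    qed
  qed (use assms in measurable)
qed fact

lemma L2fun_add:
  assumes "L2fun M f" "L2fun M g"
  shows "L2fun M (\<lambda>x. f x + g x)"
proof -
  have "integrable M (\<lambda>x. (f x)\<^sup>2 + (g x)\<^sup>2 + 2 * (f x * g x))"
    using assms L2fun_mult_integrable[OF assms] by (auto simp: L2fun_def)
  then show ?thesis using assms by (auto simp: L2fun_def power2_sum mult.assoc)
qed

lemma L2fun_cmult: "L2fun M f \<Longrightarrow> L2fun M (\<lambda>x. c * f x)"
  by (auto simp: L2fun_def power_mult_distrib)

lemma L2fun_diff:
  assumes "L2fun M f" "L2fun M g"
  shows "L2fun M (\<lambda>x. f x - g x)"
  using L2fun_add[OF assms(1) L2fun_cmult[OF assms(2), of "-1"]] by simp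

lemma L2fun_indicator_mult:
  assumes "L2fun M f" "A \<in> sets M"
  shows "L2fun M (\<lambda>x. indicator A x * f x)"
proof (rule L2fun_bound[OF assms(1), where C=1])
  show "(\<lambda>x. indicator A x * f x) \<in> borel_measurable M"
    using L2fun_measurable[OF assms(1)] assms(2) by measurable
qed (auto simp: indicator_def)

lemma (in finite_measure) L2fun_const: "L2fun M (\<lambda>x. c)"
  by (simp add: L2fun_def)

lemma (in finite_measure) L2fun_integrable: "L2fun M f \<Longrightarrow> integrable M f"
  using L2fun_mult_integrable[OF _ L2fun_const[of 1]] by simp

text \<open>Integrating the square of \<open>c * g x - m * f x\<close> gives \<open>c\<close> times
  the claim, without square roots or norms. The factor \<open>c\<close> forces the separate case
  \<open>c = 0\<close>, in which \<open>f\<close> vanishes almost everywhere and hence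
  \<open>m = 0\<close>.\<close>

lemma L2fun_Cauchy_Schwarz:
  assumes "L2fun M f" "L2fun M g"
  shows "(\<integral>x. f x * g x \<partial>M)\<^sup>2 \<le> (\<integral>x. (f x)\<^sup>2 \<partial>M) * (\<integral>x. (g x)\<^sup>2 \<partial>M)"
proof -
  define c m where "c = (\<integral>x. (f x)\<^sup>2 \<partial>M)" and "m = (\<integral>x. f x * g x \<partial>M)"
  have c0: "c \<ge> 0" by (simp add: c_def)
  note [simp] = L2fun_square[OF assms(1)] L2fun_square[OF assms(2)] L2fun_mult_integrable[OF assms]
  have "0 \<le> (\<integral>x. (c * g x - m * f x)\<^sup>2 \<partial>M)" by simp
  also have "\<dots> = (\<integral>x. c\<^sup>2 * (g x)\<^sup>2 - (2 * c * m) * (f x * g x) + m\<^sup>2 * (f x)\<^sup>2 \<partial>M)"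
    by (intro Bochner_Integration.integral_cong) (auto simp: power2_eq_square algebra_simps)
  also have "\<dots> = c\<^sup>2 * (\<integral>x. (g x)\<^sup>2 \<partial>M) - (2 * c * m) * m + m\<^sup>2 * c"
    by (simp add: c_def m_def)
  finally have *: "0 \<le> c * (c * (\<integral>x. (g x)\<^sup>2 \<partial>M) - m\<^sup>2)"
    by (simp add: power2_eq_square algebra_simps)
  show ?thesis
  proof (cases "c = 0")
    case True
    then have "AE x in M. f x = 0"
      using integral_nonneg_eq_0_iff_AE[of M "\<lambda>x. (f x)\<^sup>2"] by (simp add: c_def)
    then have "m = 0" unfolding m_def by (intro integral_eq_zero_AE) auto
    then show ?thesis using True by (simp add: c_def[symmetric] m_def[symmetric])
  next
    case False
    then have "0 \<le> c * (\<integral>x. (g x)\<^sup>2 \<partial>M) - m\<^sup>2" using * c0 by (simp add: zero_le_mult_iff)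
    then show ?thesis by (simp add: c_def m_def)
  qed
qed

lemma integral_indicator_square_le:
  fixes A :: "'a set"
  assumes "finite_measure M" "L2fun M f" "A \<in> sets M"
  shows "(\<integral>x. indicator A x * f x \<partial>M)\<^sup>2 \<le> measure M A * (\<integral>x. (f x)\<^sup>2 \<partial>M)"
proof -
  interpret finite_measure M by fact
  have "L2fun M (indicat_real A)" using L2fun_indicator_mult[OF L2fun_const[of 1] assms(3)] by simp
  moreover have "(\<lambda>x. (indicat_real A x)\<^sup>2) = indicator A" by (auto simp: indicator_def)
  ultimately show ?thesis using L2fun_Cauchy_Schwarz[of M "indicator A" f] assms by simp
qed

section \<open>Slices and bounded kernels on a product of finite measures\<close>

lemma finite_pair_sigma_finite:
  "finite_measure M \<Longrightarrow> finite_measure N \<Longrightarrow> pair_sigma_finite M N"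
  by (simp add: pair_sigma_finite_def finite_measure_def)

lemma L2fun_slices:
  assumes "finite_measure M" "finite_measure N" "L2fun (M \<Otimes>\<^sub>M N) u"
  shows "AE t in M. L2fun N (\<lambda>x. u (t, x))" "AE x in N. L2fun M (\<lambda>t. u (t, x))"
proof -
  interpret pair_sigma_finite M N by (rule finite_pair_sigma_finite) fact+
  note [measurable] = L2fun_measurable[OF assms(3)]
  have i: "integrable (M \<Otimes>\<^sub>M N) (\<lambda>z. (u z)\<^sup>2)" using assms by (simp add: L2fun_def)
  have "AE t in M. t \<in> space M" by simp
  with AE_integrable_fst'[OF i] show "AE t in M. L2fun N (\<lambda>x. u (t, x))"
    by eventually_elim (simp add: L2fun_def)
  have "AE x in N. x \<in> space N" by simp
  moreover have "AE x in N. integrable M (\<lambda>t. (u (t,x))\<^sup>2)"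
    by (rule AE_integrable_snd) (use i in \<open>simp add: case_prod_beta'\<close>)
  ultimately show "AE x in N. L2fun M (\<lambda>t. u (t, x))"
    by eventually_elim (simp add: L2fun_def)
qed

lemma L2fun_swap:
  assumes "finite_measure M" "finite_measure N" "L2fun (M \<Otimes>\<^sub>M N) u"
  shows "L2fun (N \<Otimes>\<^sub>M M) (\<lambda>z. u (snd z, fst z))"
proof -
  interpret pair_sigma_finite M N by (rule finite_pair_sigma_finite) fact+
  note [measurable] = L2fun_measurable[OF assms(3)]
  show ?thesis using integrable_product_swap[OF L2fun_square[OF assms(3)]]
    by (simp add: L2fun_def case_prod_beta')
qed

text \<open>Cauchy-Schwarz in \<open>s\<close> bounds the squared integral by the total mass of
  \<open>M\<close> times \<open>S x\<close>, independently of \<open>t\<close>. As \<open>S\<close>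
  is integrable and \<open>M\<close> finite, this is an integrable majorant on the product. The
  kernels used later are the indicators of \<open>s > t\<close> and \<open>s < t\<close>, which
  produce primitives from either end.\<close>

lemma L2fun_kernel_fst:
  fixes M :: "real measure" and k :: "real \<times> real \<Rightarrow> real"
  assumes M: "finite_measure M" and N: "finite_measure N" and sM [measurable_cong]: "sets M = sets borel"
    and u: "L2fun (M \<Otimes>\<^sub>M N) u"
    and [measurable]: "k \<in> borel_measurable (borel \<Otimes>\<^sub>M borel)" and k: "\<And>z. \<bar>k z\<bar> \<le> 1"
  shows "L2fun (M \<Otimes>\<^sub>M N) (\<lambda>z. \<integral>s. k (fst z, s) * u (s, snd z) \<partial>M)"
proof -
  interpret M: finite_measure M by fact
  interpret N: finite_measure N by fact
  interpret pair_sigma_finite M N by (rule finite_pair_sigma_finite) fact+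
  note [measurable] = L2fun_measurable[OF u]
  have [simp]: "space M = UNIV" using sets_eq_imp_space_eq[OF sM] by simp
  define S where "S x = (\<integral>s. (u (s, x))\<^sup>2 \<partial>M)" for x
  have iS: "integrable N S"
    unfolding S_def by (rule integrable_snd) (use L2fun_square[OF u] in \<open>simp add: case_prod_beta'\<close>)
  have [measurable]: "S \<in> borel_measurable N" using iS by simp
  have kL: "L2fun M (\<lambda>s. k (t, s))" for t
    by (rule L2fun_bound[OF M.L2fun_const[of 1], where C=1]) (use k in auto)
  have k2: "(\<integral>s. (k (t, s))\<^sup>2 \<partial>M) \<le> measure M UNIV" for t
  proof -
    have "(\<integral>s. (k (t, s))\<^sup>2 \<partial>M) \<le> (\<integral>s. 1 \<partial>M)"
      using L2fun_square[OF kL[of t]] k by (intro integral_mono) (auto simp: abs_square_le_1)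
    then show ?thesis by simp
  qed
  have "AE x in N. \<forall>t. (\<integral>s. k (t, s) * u (s, x) \<partial>M)\<^sup>2 \<le> measure M UNIV * S x"
    using L2fun_slices(2)[OF M N u]
  proof eventually_elim
    case (elim x)
    show ?case
    proof
      fix t
      have "(\<integral>s. k (t, s) * u (s, x) \<partial>M)\<^sup>2 \<le> (\<integral>s. (k (t, s))\<^sup>2 \<partial>M) * S x"
        unfolding S_def by (rule L2fun_Cauchy_Schwarz[OF kL elim])
      also have "\<dots> \<le> measure M UNIV * S x"
        using k2 by (intro mult_right_mono) (auto simp: S_def)
      finally show "(\<integral>s. k (t, s) * u (s, x) \<partial>M)\<^sup>2 \<le> measure M UNIV * S x" .
    qed
  qed
  then have "AE x in N. (\<integral>s. k (t, s) * u (s, x) \<partial>M)\<^sup>2 \<le> measure M UNIV * S x" for t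
    by eventually_elim simp
  then have "AE t in M. AE x in N. (\<integral>s. k (t, s) * u (s, x) \<partial>M)\<^sup>2 \<le> measure M UNIV * S x"
    by simp
  then have ae: "AE z in M \<Otimes>\<^sub>M N. (\<integral>s. k (fst z, s) * u (s, snd z) \<partial>M)\<^sup>2 \<le> measure M UNIV * S (snd z)"
    by (intro AE_pair_measure) auto
  have iS2: "integrable (M \<Otimes>\<^sub>M N) (\<lambda>z. measure M UNIV * S (snd z))"
  proof (rule Fubini_integrable)
    show "AE x in M. integrable N (\<lambda>y. Sigma_Algebra.measure M UNIV * S (snd (x, y)))" using iS by simp
  qed (auto simp: abs_mult)
  show ?thesis unfolding L2fun_def
  proof
    show "integrable (M \<Otimes>\<^sub>M N) (\<lambda>z. (\<integral>s. k (fst z, s) * u (s, snd z) \<partial>M)\<^sup>2)"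
      by (rule Bochner_Integration.integrable_bound[OF iS2]) (use ae in \<open>auto elim!: eventually_mono\<close>)
  qed measurable
qed

lemma L2fun_kernel_snd:
  fixes N :: "real measure" and k :: "real \<times> real \<Rightarrow> real"
  assumes M: "finite_measure M" and N: "finite_measure N" and sN: "sets N = sets borel"
    and u: "L2fun (M \<Otimes>\<^sub>M N) u"
    and k: "k \<in> borel_measurable (borel \<Otimes>\<^sub>M borel)" "\<And>z. \<bar>k z\<bar> \<le> 1"
  shows "L2fun (M \<Otimes>\<^sub>M N) (\<lambda>z. \<integral>y. k (snd z, y) * u (fst z, y) \<partial>N)"
  using L2fun_swap[OF N M L2fun_kernel_fst[OF N M sN L2fun_swap[OF M N u] k]] by simp

section \<open>Fubini's theorem on a triangle, in place of integration by parts\<close>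

lemma triangle_swap:
  fixes M :: "real measure" and f g :: "real \<Rightarrow> real"
  assumes M: "finite_measure M" and sM [measurable_cong]: "sets M = sets borel"
    and f: "integrable M f" and g: "integrable M g"
  shows "(\<integral>t. f t * (\<integral>s. indicator {t<..} s * g s \<partial>M) \<partial>M)
       = (\<integral>s. g s * (\<integral>t. indicator {..<s} t * f t \<partial>M) \<partial>M)"
proof -
  interpret M: finite_measure M by fact
  interpret pair_sigma_finite M M by (rule finite_pair_sigma_finite) fact+
  note [measurable] = borel_measurable_integrable[OF f] borel_measurable_integrable[OF g]
  have "integrable (M \<Otimes>\<^sub>M M) (\<lambda>z. f (fst z) * g (snd z))"
    by (rule Fubini_integrable) (use f g in \<open>auto simp: abs_mult\<close>)
  then have int: "integrable (M \<Otimes>\<^sub>M M) (\<lambda>(t, s). f t * (indicator {t<..} s * g s))"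
    by (rule Bochner_Integration.integrable_bound)
       (auto simp: indicator_def abs_mult case_prod_beta' greaterThan_def)
  have "(\<integral>t. f t * (\<integral>s. indicator {t<..} s * g s \<partial>M) \<partial>M) = (\<integral>t. (\<integral>s. f t * (indicator {t<..} s * g s) \<partial>M) \<partial>M)"
    by simp
  also have "\<dots> = (\<integral>s. (\<integral>t. f t * (indicator {t<..} s * g s) \<partial>M) \<partial>M)"
    using Fubini_integral[OF int] by simp
  also have "\<dots> = (\<integral>s. (\<integral>t. g s * (indicator {..<s} t * f t) \<partial>M) \<partial>M)"
    by (intro Bochner_Integration.integral_cong) (auto simp: indicator_def)
  finally show ?thesis by simp
qed

text \<open>The stand-in for the chain rule: \<open>f\<close> times its primitive is half the
  derivative of the squared primitive. The two integrals run over opposite triangles and are equal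
  by \<open>triangle_swap\<close>; together they fill the square up to the points
  \<open>s = t\<close>, which are null by \<open>no_atoms\<close>.\<close>

lemma triangle_square:
  fixes M :: "real measure" and f :: "real \<Rightarrow> real"
  assumes M: "finite_measure M" and sM [measurable_cong]: "sets M = sets borel"
    and f: "integrable M f" and no_atoms: "\<And>t. AE s in M. s \<noteq> t"
  shows "(\<integral>t. f t * (\<integral>s. indicator {..<t} s * f s \<partial>M) \<partial>M) = (\<integral>t. f t \<partial>M)\<^sup>2 / 2" (is "?L = _")
    and "(\<integral>t. f t * (\<integral>s. indicator {t<..} s * f s \<partial>M) \<partial>M) = (\<integral>t. f t \<partial>M)\<^sup>2 / 2" (is "?R = _")
proof -
  interpret M: finite_measure M by fact
  interpret pair_sigma_finite M M by (rule finite_pair_sigma_finite) fact+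
  note [measurable] = borel_measurable_integrable[OF f]
  have i1: "integrable M (\<lambda>s. indicator {..<t} s * f s)" "integrable M (\<lambda>s. indicator {t<..} s * f s)" for t
    by (rule Bochner_Integration.integrable_bound[OF f]; auto simp: indicator_def)+
  have b: "\<bar>\<integral>s. indicator A s * f s \<partial>M\<bar> \<le> (\<integral>s. \<bar>f s\<bar> \<partial>M)" if [measurable]: "A \<in> sets borel" for A
    by (rule order_trans[OF integral_abs_bound])
       (intro integral_mono Bochner_Integration.integrable_bound[OF f], auto simp: indicator_def f abs_mult)
  have i2: "integrable M (\<lambda>t. f t * (\<integral>s. indicator {..<t} s * f s \<partial>M))"
    "integrable M (\<lambda>t. f t * (\<integral>s. indicator {t<..} s * f s \<partial>M))"
    by (rule Bochner_Integration.integrable_bound[OF integrable_mult_left[OF f, of "\<integral>s. \<bar>f s\<bar> \<partial>M"]];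
        auto simp: abs_mult lessThan_def greaterThan_def intro!: mult_left_mono order_trans[OF b[unfolded lessThan_def greaterThan_def]])+
  have split: "(\<integral>s. indicator {..<t} s * f s \<partial>M) + (\<integral>s. indicator {t<..} s * f s \<partial>M) = (\<integral>s. f s \<partial>M)" for t
  proof -
    have "(\<integral>s. indicator {..<t} s * f s \<partial>M) + (\<integral>s. indicator {t<..} s * f s \<partial>M)
      = (\<integral>s. indicator {..<t} s * f s + indicator {t<..} s * f s \<partial>M)" using i1 by simp
    also have "\<dots> = (\<integral>s. f s \<partial>M)"
      using no_atoms[of t] by (intro integral_cong_AE) (auto simp: indicator_def elim!: eventually_mono)
    finally show ?thesis .
  qed
  have "?L + ?R = (\<integral>t. f t * (\<integral>s. f s \<partial>M) \<partial>M)"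
    using i2 by (simp add: Bochner_Integration.integral_add[symmetric] distrib_left[symmetric] split)
  then have "?L + ?R = (\<integral>t. f t \<partial>M)\<^sup>2" by (simp add: power2_eq_square)
  moreover have "?L = ?R" using triangle_swap[OF M sM f f] by simp
  ultimately show "?L = (\<integral>t. f t \<partial>M)\<^sup>2 / 2" "?R = (\<integral>t. f t \<partial>M)\<^sup>2 / 2" by auto
qed

text \<open>\<open>triangle_swap\<close> on almost every section in time. In this form a primitive
  over later times, sitting on a test function, becomes a primitive over earlier times on the other
  factor.\<close>

lemma triangle_swap_fst:
  fixes M :: "real measure"
  assumes M: "finite_measure M" and N: "finite_measure N" and sM [measurable_cong]: "sets M = sets borel"
    and f: "L2fun (M \<Otimes>\<^sub>M N) f" and g: "L2fun (M \<Otimes>\<^sub>M N) g"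
  shows "(\<integral>z. f z * (\<integral>s. indicator {fst z<..} s * g (s, snd z) \<partial>M) \<partial>(M \<Otimes>\<^sub>M N))
       = (\<integral>z. g z * (\<integral>s. indicator {..<fst z} s * f (s, snd z) \<partial>M) \<partial>(M \<Otimes>\<^sub>M N))"
proof -
  interpret M: finite_measure M by fact
  interpret pair_sigma_finite M N by (rule finite_pair_sigma_finite) fact+
  note [measurable] = L2fun_measurable[OF f] L2fun_measurable[OF g]
  have 1: "L2fun (M \<Otimes>\<^sub>M N) (\<lambda>z. \<integral>s. indicator {fst z<..} s * g (s, snd z) \<partial>M)"
    using L2fun_kernel_fst[OF M N sM g, of "\<lambda>z. indicator {fst z<..} (snd z)"]
    by (simp add: greaterThan_def indicator_def)
  have 2: "L2fun (M \<Otimes>\<^sub>M N) (\<lambda>z. \<integral>s. indicator {..<fst z} s * f (s, snd z) \<partial>M)"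
    using L2fun_kernel_fst[OF M N sM f, of "\<lambda>z. indicator {..<fst z} (snd z)"]
    by (simp add: lessThan_def indicator_def)
  have "(\<integral>z. f z * (\<integral>s. indicator {fst z<..} s * g (s, snd z) \<partial>M) \<partial>(M \<Otimes>\<^sub>M N))
    = (\<integral>x. (\<integral>t. f (t, x) * (\<integral>s. indicator {t<..} s * g (s, x) \<partial>M) \<partial>M) \<partial>N)"
    using L2fun_mult_integrable[OF f 1] by (subst integral_snd) (simp_all add: case_prod_beta')
  also have "\<dots> = (\<integral>x. (\<integral>t. g (t, x) * (\<integral>s. indicator {..<t} s * f (s, x) \<partial>M) \<partial>M) \<partial>N)"
  proof (intro integral_cong_AE)
    show "AE x in N. (\<integral>t. f (t, x) * (\<integral>s. indicator {t<..} s * g (s, x) \<partial>M) \<partial>M)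
       = (\<integral>t. g (t, x) * (\<integral>s. indicator {..<t} s * f (s, x) \<partial>M) \<partial>M)"
      using L2fun_slices(2)[OF M N f] L2fun_slices(2)[OF M N g]
      by eventually_elim (intro triangle_swap M sM M.L2fun_integrable)
  qed (simp_all add: lessThan_def greaterThan_def)
  also have "\<dots> = (\<integral>z. g z * (\<integral>s. indicator {..<fst z} s * f (s, snd z) \<partial>M) \<partial>(M \<Otimes>\<^sub>M N))"
    using L2fun_mult_integrable[OF g 2] by (subst integral_snd) (simp_all add: case_prod_beta')
  finally show ?thesis .
qed

lemma triangle_swap_snd:
  fixes N :: "real measure"
  assumes M: "finite_measure M" and N: "finite_measure N" and sN [measurable_cong]: "sets N = sets borel"
    and f: "L2fun (M \<Otimes>\<^sub>M N) f" and g: "L2fun (M \<Otimes>\<^sub>M N) g"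
  shows "(\<integral>z. f z * (\<integral>y. indicator {..<snd z} y * g (fst z, y) \<partial>N) \<partial>(M \<Otimes>\<^sub>M N))
       = (\<integral>z. g z * (\<integral>y. indicator {snd z<..} y * f (fst z, y) \<partial>N) \<partial>(M \<Otimes>\<^sub>M N))"
proof -
  interpret N: finite_measure N by fact
  interpret pair_sigma_finite M N by (rule finite_pair_sigma_finite) fact+
  note [measurable] = L2fun_measurable[OF f] L2fun_measurable[OF g]
  show ?thesis
    using triangle_swap_fst[OF N M sN L2fun_swap[OF M N g] L2fun_swap[OF M N f]]
      integral_product_swap[of "\<lambda>z. f z * (\<integral>y. indicator {..<snd z} y * g (fst z, y) \<partial>N)"]
      integral_product_swap[of "\<lambda>z. g z * (\<integral>y. indicator {snd z<..} y * f (fst z, y) \<partial>N)"]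
    by (simp add: case_prod_beta' lessThan_def greaterThan_def)
qed

section \<open>Test functions and weak derivatives\<close>

lemma L2fun_bounded_mult:
  assumes "L2fun M f" "k \<in> borel_measurable M" "\<And>x. \<bar>k x\<bar> \<le> C"
  shows "L2fun M (\<lambda>x. k x * f x)"
  by (rule L2fun_bound[OF assms(1), where C=C])
     (use assms L2fun_measurable[OF assms(1)] in \<open>auto simp: abs_mult intro!: mult_right_mono\<close>)

lemma AE_pair_snd:
  assumes M: "finite_measure M" and N: "finite_measure N" and "AE x in N. P x"
  shows "AE z in M \<Otimes>\<^sub>M N. P (snd z)"
proof -
  interpret M: finite_measure M by fact
  interpret N: finite_measure N by fact
  interpret pair_sigma_finite M N by (rule finite_pair_sigma_finite) fact+
  obtain N0 where N0: "{x \<in> space N. \<not> P x} \<subseteq> N0" "emeasure N N0 = 0" "N0 \<in> sets N"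
    using AE_E[OF assms(3)] by blast
  have "emeasure (M \<Otimes>\<^sub>M N) (space M \<times> N0) = 0"
    using N0 by (simp add: N.emeasure_pair_measure_Times)
  with N0 show ?thesis
    by (intro AE_I[of _ _ "space M \<times> N0"]) (auto simp: space_pair_measure)
qed

lemma L2fun_snd:
  assumes M: "finite_measure M" and N: "finite_measure N" and f: "L2fun N f"
  shows "L2fun (M \<Otimes>\<^sub>M N) (\<lambda>z. f (snd z))"
proof -
  interpret M: finite_measure M by fact
  interpret pair_sigma_finite M N by (rule finite_pair_sigma_finite) fact+
  note [measurable] = L2fun_measurable[OF f]
  show ?thesis unfolding L2fun_def
  proof
    show "integrable (M \<Otimes>\<^sub>M N) (\<lambda>z. (f (snd z))\<^sup>2)"
      by (rule Fubini_integrable) (use L2fun_square[OF f] in auto)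
  qed measurable
qed

context
  fixes a b :: real and \<phi> :: "real \<Rightarrow> real"
  assumes \<phi>: "test_fun a b \<phi>"
begin

lemma test_fun_DERIV: "(\<phi> has_real_derivative deriv \<phi> x) (at x)"
proof -
  have "((deriv ^^ 0) \<phi>) differentiable (at x)" using \<phi> unfolding test_fun_def by blast
  then show ?thesis by (simp add: DERIV_deriv_iff_real_differentiable)
qed

lemma test_fun_cont_deriv: "isCont (deriv \<phi>) x"
proof -
  have "((deriv ^^ 1) \<phi>) differentiable (at x)" using \<phi> unfolding test_fun_def by blast
  then show ?thesis by (simp add: differentiable_imp_continuous_within)
qed

lemma test_fun_measurable:
  "\<phi> \<in> borel_measurable borel" "deriv \<phi> \<in> borel_measurable borel"
  using test_fun_cont_deriv DERIV_isCont[OF test_fun_DERIV]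
  by (auto intro!: borel_measurable_continuous_onI continuous_at_imp_continuous_on)

lemma test_fun_zero: "\<phi> a = 0" "\<phi> b = 0"
  using \<phi> unfolding test_fun_def by fastforce+

text \<open>Off the compact interval carrying the support both functions vanish, the derivative
  because the complement is open and \<phi> is locally zero there. Boundedness is what makes
  products with merely integrable functions integrable.\<close>

lemma test_fun_bounded: obtains C where "\<And>x. \<bar>\<phi> x\<bar> \<le> C" "\<And>x. \<bar>deriv \<phi> x\<bar> \<le> C"
proof -
  obtain c d where z: "\<And>x. x \<notin> {c..d} \<Longrightarrow> \<phi> x = 0" using \<phi> unfolding test_fun_def by blast
  have z': "deriv \<phi> x = 0" if "x \<notin> {c..d}" for x
  proof -
    have "((\<lambda>x. 0) has_real_derivative 0) (at x)" by simp
    then have "(\<phi> has_real_derivative 0) (at x)"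
      by (rule has_field_derivative_transform_within_open[where S="- {c..d}"])
         (use that in \<open>auto simp: z\<close>)
    then show ?thesis by (rule DERIV_imp_deriv)
  qed
  have "bounded (\<phi> ` {c..d})" "bounded (deriv \<phi> ` {c..d})"
    using test_fun_cont_deriv DERIV_isCont[OF test_fun_DERIV]
    by (auto intro!: compact_imp_bounded compact_continuous_image continuous_at_imp_continuous_on)
  then obtain C D where CD: "\<And>x. x \<in> {c..d} \<Longrightarrow> \<bar>\<phi> x\<bar> \<le> C" "\<And>x. x \<in> {c..d} \<Longrightarrow> \<bar>deriv \<phi> x\<bar> \<le> D"
    unfolding bounded_iff real_norm_def by (metis imageI)
  show ?thesis
  proof (rule that[of "max 0 (max C D)"])
    show "\<bar>\<phi> x\<bar> \<le> max 0 (max C D)" for x using CD(1)[of x] z[of x] by (cases "x \<in> {c..d}") auto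
    show "\<bar>deriv \<phi> x\<bar> \<le> max 0 (max C D)" for x using CD(2)[of x] z'[of x] by (cases "x \<in> {c..d}") auto
  qed
qed

lemma test_fun_integral:
  assumes s: "s \<in> {a<..<b}"
  shows "(\<integral>t. indicator {..<s} t * deriv \<phi> t \<partial>leb_on {a<..<b}) = \<phi> s" (is "?L = _")
    and "(\<integral>t. indicator {s<..} t * deriv \<phi> t \<partial>leb_on {a<..<b}) = - \<phi> s" (is "?R = _")
proof -
  note [measurable] = test_fun_measurable
  \<comment> \<open>The open and half-open intervals differ from closed ones only in these three
    points, so the fundamental theorem on closed intervals applies.\<close>
  have ne: "AE t in lborel. t \<noteq> a \<and> t \<noteq> b \<and> t \<noteq> s"
    using AE_lborel_singleton[of a] AE_lborel_singleton[of b] AE_lborel_singleton[of s] by auto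
  have "?L = (\<integral>t. indicat_real {a<..<b} t *\<^sub>R (indicator {..<s} t * deriv \<phi> t) \<partial>lborel)"
    unfolding leb_on_def by (subst integral_density) auto
  also have "\<dots> = (\<integral>t. deriv \<phi> t * indicator {a..s} t \<partial>lborel)"
    by (intro integral_cong_AE, simp, simp, use ne in eventually_elim) (use s in \<open>auto simp: indicator_def\<close>)
  also have "\<dots> = \<phi> s - \<phi> a"
    by (rule integral_FTC_Icc_real) (use s test_fun_DERIV test_fun_cont_deriv in auto)
  finally show "?L = \<phi> s" using test_fun_zero by simp
  have "?R = (\<integral>t. indicat_real {a<..<b} t *\<^sub>R (indicator {s<..} t * deriv \<phi> t) \<partial>lborel)"
    unfolding leb_on_def by (subst integral_density) auto
  also have "\<dots> = (\<integral>t. deriv \<phi> t * indicator {s..b} t \<partial>lborel)"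
    by (intro integral_cong_AE, simp, simp, use ne in eventually_elim) (use s in \<open>auto simp: indicator_def\<close>)
  also have "\<dots> = \<phi> b - \<phi> s"
    by (rule integral_FTC_Icc_real) (use s test_fun_DERIV test_fun_cont_deriv in auto)
  finally show "?R = - \<phi> s" using test_fun_zero by simp
qed

end

section \<open>The predicates of the statement in terms of Borel representatives\<close>

lemma L2_int_iff:
  assumes [measurable]: "g \<in> borel_measurable borel" and "AE x in leb_on {a<..<b}. f x = g x"
  shows "L2_int a b f \<longleftrightarrow> L2fun (leb_on {a<..<b}) g"
proof -
  have "AE x in leb_on {a<..<b}. (f x)\<^sup>2 = (g x)\<^sup>2" using assms(2) by eventually_elim simp
  then have "set_integrable lebesgue {a<..<b} (\<lambda>x. (f x)\<^sup>2) \<longleftrightarrow> integrable (leb_on {a<..<b}) (\<lambda>x. (g x)\<^sup>2)"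
    by (intro set_integrable_leb_on) auto
  moreover have "set_borel_measurable lebesgue {a<..<b} f"
    using assms by (intro set_borel_measurable_leb_on) auto
  ultimately show ?thesis by (simp add: L2_int_def L2fun_def)
qed

lemma L2_Q_iff:
  assumes [measurable]: "g \<in> borel_measurable borel" and "AE z in leb_on (Qset T). unc u z = g z"
  shows "L2_Q T u \<longleftrightarrow> L2fun (leb_on (Qset T)) g"
proof -
  have "AE x in leb_on (Qset T). (unc u x)\<^sup>2 = (g x)\<^sup>2" using assms(2) by eventually_elim simp
  then have "set_integrable lebesgue (Qset T) (\<lambda>x. (unc u x)\<^sup>2) \<longleftrightarrow> integrable (leb_on (Qset T)) (\<lambda>x. (g x)\<^sup>2)"
    by (intro set_integrable_leb_on) auto
  moreover have "set_borel_measurable lebesgue (Qset T) (unc u)"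
    using assms by (intro set_borel_measurable_leb_on) auto
  ultimately show ?thesis by (simp add: L2_Q_def L2fun_def)
qed

lemma weak_deriv_on_iff:
  assumes [measurable]: "f \<in> borel_measurable borel" "g \<in> borel_measurable borel"
    and f: "AE x in leb_on {a<..<b}. f0 x = f x" and g: "AE x in leb_on {a<..<b}. g0 x = g x"
  shows "weak_deriv_on a b f0 g0 \<longleftrightarrow> integrable (leb_on {a<..<b}) f \<and> integrable (leb_on {a<..<b}) g \<and>
    (\<forall>\<phi>. test_fun a b \<phi> \<longrightarrow> (\<integral>x. f x * deriv \<phi> x \<partial>leb_on {a<..<b}) = - (\<integral>x. g x * \<phi> x \<partial>leb_on {a<..<b}))"
proof -
  have "(LINT x:{a<..<b}|lebesgue. f0 x * deriv \<phi> x) = (\<integral>x. f x * deriv \<phi> x \<partial>leb_on {a<..<b})"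
    "(LINT x:{a<..<b}|lebesgue. g0 x * \<phi> x) = (\<integral>x. g x * \<phi> x \<partial>leb_on {a<..<b})" if \<phi>: "test_fun a b \<phi>" for \<phi>
  proof -
    note [measurable] = test_fun_measurable[OF \<phi>]
    show "(LINT x:{a<..<b}|lebesgue. f0 x * deriv \<phi> x) = (\<integral>x. f x * deriv \<phi> x \<partial>leb_on {a<..<b})"
      by (rule set_lebesgue_integral_leb_on) (use f in \<open>auto elim!: eventually_mono\<close>)
    show "(LINT x:{a<..<b}|lebesgue. g0 x * \<phi> x) = (\<integral>x. g x * \<phi> x \<partial>leb_on {a<..<b})"
      by (rule set_lebesgue_integral_leb_on) (use g in \<open>auto elim!: eventually_mono\<close>)
  qed
  moreover have "set_integrable lebesgue {a<..<b} f0 \<longleftrightarrow> integrable (leb_on {a<..<b}) f"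
    "set_integrable lebesgue {a<..<b} g0 \<longleftrightarrow> integrable (leb_on {a<..<b}) g"
    by (intro set_integrable_leb_on f g; simp)+
  ultimately show ?thesis unfolding weak_deriv_on_def by auto
qed

text \<open>\<open>triangle_swap\<close> moves the primitive from \<open>g\<close> to
  \<open>deriv \<phi>\<close>, whose integral over \<open>x > y\<close> is \<open>- \<phi> y\<close>
  because \<phi> vanishes at \<open>b\<close>. This supplies test functions with a prescribed space
  derivative.\<close>

lemma weak_deriv_on_indefinite_integral:
  assumes g: "integrable (leb_on {a<..<b}) g"
  shows "weak_deriv_on a b (\<lambda>x. \<integral>y. indicator {..<x} y * g y \<partial>leb_on {a<..<b}) g"
proof -
  let ?N = "leb_on {a<..<b}"
  interpret N: finite_measure ?N by (rule finite_measure_leb_on_interval)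
  have gb: "g \<in> borel_measurable ?N" using g by simp
  then have [measurable]: "g \<in> borel_measurable borel" by simp
  have m: "(\<lambda>x. \<integral>y. indicator {..<x} y * g y \<partial>?N) \<in> borel_measurable borel"
    by (simp add: lessThan_def)
  have b: "\<bar>\<integral>y. indicator {..<x} y * g y \<partial>?N\<bar> \<le> (\<integral>y. \<bar>g y\<bar> \<partial>?N)" for x
    by (rule order_trans[OF integral_abs_bound])
       (intro integral_mono Bochner_Integration.integrable_bound[OF g], auto simp: indicator_def g abs_mult)
  have "integrable ?N (\<lambda>x. \<integral>y. indicator {..<x} y * g y \<partial>?N)"
    by (rule N.integrable_const_bound[of _ "\<integral>y. \<bar>g y\<bar> \<partial>?N"]) (use b m in auto)
  moreover have "(\<integral>x. (\<integral>y. indicator {..<x} y * g y \<partial>?N) * deriv \<phi> x \<partial>?N) = - (\<integral>x. g x * \<phi> x \<partial>?N)"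
    if \<phi>: "test_fun a b \<phi>" for \<phi>
  proof -
    note [measurable] = test_fun_measurable[OF \<phi>]
    obtain C where C: "\<And>x. \<bar>\<phi> x\<bar> \<le> C" "\<And>x. \<bar>deriv \<phi> x\<bar> \<le> C" using test_fun_bounded[OF \<phi>] by blast
    have i: "integrable ?N (deriv \<phi>)" by (rule N.integrable_const_bound[of _ C]) (use C in auto)
    have "(\<integral>x. (\<integral>y. indicator {..<x} y * g y \<partial>?N) * deriv \<phi> x \<partial>?N)
      = (\<integral>y. g y * (\<integral>x. indicator {y<..} x * deriv \<phi> x \<partial>?N) \<partial>?N)"
      using triangle_swap[OF N.finite_measure_axioms _ g i] by (simp add: mult.commute)
    also have "\<dots> = (\<integral>y. - (g y * \<phi> y) \<partial>?N)"
    proof (intro integral_cong_AE)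
      show "AE y in ?N. g y * (\<integral>x. indicator {y<..} x * deriv \<phi> x \<partial>?N) = - (g y * \<phi> y)"
        using AE_leb_on_interval[of a b] by eventually_elim (auto simp: test_fun_integral[OF \<phi>])
    qed (simp_all add: greaterThan_def)
    finally show ?thesis by simp
  qed
  ultimately show ?thesis
    using g m by (subst weak_deriv_on_iff[where f="\<lambda>x. \<integral>y. indicator {..<x} y * g y \<partial>?N" and g=g]) auto
qed

section \<open>Primitives in time as test functions\<close>

abbreviation (input) leb_Q :: "real \<Rightarrow> (real \<times> real) measure" where
  "leb_Q T \<equiv> leb_on {0<..<T} \<Otimes>\<^sub>M leb_on {0<..<1}"

lemma L2_Q_of_L2fun:
  assumes u: "L2fun (leb_Q T) u"
  shows "L2_Q T (\<lambda>t x. u (t, x))"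
proof -
  have "u \<in> borel_measurable borel" using L2fun_measurable[OF u] by (simp add: leb_on_Qset)
  moreover have "AE z in leb_on (Qset T). unc (\<lambda>t x. u (t, x)) z = u z" by (simp add: unc_def)
  ultimately show ?thesis using u L2_Q_iff by (simp add: leb_on_Qset)
qed

text \<open>The test functions of the proof. The measure already confines \<open>s\<close> to (0,T),
  so the value is defined for every real time, including the endpoints 0 and T where the weak
  formulation evaluates it. Integrating over later times gives the required zero at T, at the price
  of the sign in the time derivative \<open>- u\<close>.\<close>

definition int_after :: "real \<Rightarrow> (real \<times> real \<Rightarrow> real) \<Rightarrow> real \<times> real \<Rightarrow> real" where
  "int_after T u z = (\<integral>s. indicator {fst z<..} s * u (s, snd z) \<partial>leb_on {0<..<T})"

definition int_before :: "real \<Rightarrow> (real \<times> real \<Rightarrow> real) \<Rightarrow> real \<times> real \<Rightarrow> real" where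
  "int_before T u z = (\<integral>s. indicator {..<fst z} s * u (s, snd z) \<partial>leb_on {0<..<T})"

lemma L2fun_int_after: "L2fun (leb_Q T) u \<Longrightarrow> L2fun (leb_Q T) (int_after T u)"
  using L2fun_kernel_fst[of "leb_on {0<..<T}" "leb_on {0<..<1}" u "\<lambda>z. indicator {fst z<..} (snd z)"]
  by (simp add: int_after_def[abs_def] greaterThan_def indicator_def finite_measure_leb_on_interval)

lemma L2fun_int_before: "L2fun (leb_Q T) u \<Longrightarrow> L2fun (leb_Q T) (int_before T u)"
  using L2fun_kernel_fst[of "leb_on {0<..<T}" "leb_on {0<..<1}" u "\<lambda>z. indicator {..<fst z} (snd z)"]
  by (simp add: int_before_def[abs_def] lessThan_def indicator_def finite_measure_leb_on_interval)

text \<open>Cauchy-Schwarz in time for almost every \<open>x\<close>, then Fubini. For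
  \<open>A\<close> a window between two times the factor \<open>measure (leb_on {0<..<T}) A\<close>
  gives continuity in time; for \<open>A\<close> a half-line it gives bounds at every single time,
  not only almost every one.\<close>

lemma time_integral_L2:
  assumes u: "L2fun (leb_Q T) u" and [measurable]: "A \<in> sets borel"
  shows "L2fun (leb_on {0<..<1}) (\<lambda>x. \<integral>s. indicator A s * u (s, x) \<partial>leb_on {0<..<T})" (is "L2fun ?N ?f")
    and "(\<integral>x. (\<integral>s. indicator A s * u (s, x) \<partial>leb_on {0<..<T})\<^sup>2 \<partial>leb_on {0<..<1})
      \<le> measure (leb_on {0<..<T}) A * (\<integral>z. (u z)\<^sup>2 \<partial>leb_Q T)"
proof -
  let ?M = "leb_on {0<..<T}"
  interpret M: finite_measure ?M by (rule finite_measure_leb_on_interval)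
  interpret N: finite_measure ?N by (rule finite_measure_leb_on_interval)
  interpret pair_sigma_finite ?M ?N by (rule finite_pair_sigma_finite) unfold_locales
  note MN = M.finite_measure_axioms N.finite_measure_axioms
  note [measurable] = L2fun_measurable[OF u]
  define S where "S x = (\<integral>s. (u (s, x))\<^sup>2 \<partial>?M)" for x
  have iS: "integrable ?N S"
    unfolding S_def by (rule integrable_snd) (use L2fun_square[OF u] in \<open>simp add: case_prod_beta'\<close>)
  have ae: "AE x in ?N. (?f x)\<^sup>2 \<le> measure ?M A * S x"
    using L2fun_slices(2)[OF MN u]
  proof eventually_elim
    case (elim x)
    then show ?case unfolding S_def by (intro integral_indicator_square_le MN) simp_all
  qed
  have [measurable]: "?f \<in> borel_measurable ?N"
    by (rule M.borel_measurable_lebesgue_integral) measurable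
  have i2: "integrable ?N (\<lambda>x. (?f x)\<^sup>2)"
    by (rule Bochner_Integration.integrable_bound[OF integrable_mult_right[OF iS, of "measure ?M A"]])
       (measurable, use ae in eventually_elim, auto)
  then show "L2fun ?N ?f" by (simp add: L2fun_def)
  have "(\<integral>x. (?f x)\<^sup>2 \<partial>?N) \<le> (\<integral>x. measure ?M A * S x \<partial>?N)"
    using ae i2 iS by (intro integral_mono_AE) auto
  also have "\<dots> = measure ?M A * (\<integral>x. S x \<partial>?N)" by simp
  also have "(\<integral>x. S x \<partial>?N) = (\<integral>z. (u z)\<^sup>2 \<partial>leb_Q T)"
    unfolding S_def using L2fun_square[OF u] by (subst integral_snd) (simp_all add: case_prod_beta')
  finally show "(\<integral>x. (?f x)\<^sup>2 \<partial>?N) \<le> measure ?M A * (\<integral>z. (u z)\<^sup>2 \<partial>leb_Q T)" .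
qed

text \<open>The difference of two slices is the integral of \<open>u\<close> over the window between
  the two times, so its squared H norm is at most \<open>\<bar>s - t\<bar>\<close> times the squared
  norm of \<open>u\<close> on Q.\<close>

lemma int_after_cont_H:
  assumes u: "L2fun (leb_Q T) u"
  shows "cont_H T (\<lambda>t x. int_after T u (t, x))"
proof -
  let ?M = "leb_on {0<..<T}" and ?N = "leb_on {0<..<1::real}"
  interpret M: finite_measure ?M by (rule finite_measure_leb_on_interval)
  interpret N: finite_measure ?N by (rule finite_measure_leb_on_interval)
  note MN = M.finite_measure_axioms N.finite_measure_axioms
  note [measurable] = L2fun_measurable[OF u]
  let ?C = "\<integral>z. (u z)\<^sup>2 \<partial>leb_Q T"
  have L: "L2fun ?N (\<lambda>x. int_after T u (t, x))" for t
    unfolding int_after_def using time_integral_L2(1)[OF u, of "{t<..}"] by simp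
  have le: "(LINT x:{0<..<1}|lebesgue. (int_after T u (s, x) - int_after T u (t, x))\<^sup>2) \<le> (t - s) * ?C"
    if "s \<le> t" for s t
  proof -
    have "(LINT x:{0<..<1}|lebesgue. (int_after T u (s, x) - int_after T u (t, x))\<^sup>2)
      = (\<integral>x. (\<integral>r. indicator {s<..t} r * u (r, x) \<partial>?M)\<^sup>2 \<partial>?N)"
    proof (rule set_lebesgue_integral_leb_on)
      show "AE x in ?N. (int_after T u (s, x) - int_after T u (t, x))\<^sup>2 = (\<integral>r. indicator {s<..t} r * u (r, x) \<partial>?M)\<^sup>2"
        using L2fun_slices(2)[OF MN u]
      proof eventually_elim
        case (elim x)
        have "L2fun ?M (\<lambda>r. indicator {c<..} r * u (r, x))" for c
          by (rule L2fun_indicator_mult[OF elim]) simp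
        then have "int_after T u (s, x) - int_after T u (t, x)
          = (\<integral>r. indicator {s<..} r * u (r, x) - indicator {t<..} r * u (r, x) \<partial>?M)"
          unfolding int_after_def by (subst Bochner_Integration.integral_diff) (auto intro: M.L2fun_integrable)
        also have "\<dots> = (\<integral>r. indicator {s<..t} r * u (r, x) \<partial>?M)"
          using that by (intro Bochner_Integration.integral_cong) (auto simp: indicator_def)
        finally show ?case by simp
      qed
    qed (use L2fun_measurable[OF time_integral_L2(1)[OF u, of "{s<..t}"]] in simp_all)
    also have "\<dots> \<le> measure ?M {s<..t} * ?C" by (rule time_integral_L2(2)[OF u]) simp
    also have "\<dots> \<le> (t - s) * ?C" using measure_leb_on_le[OF that] by (intro mult_right_mono) simp_all
    finally show ?thesis .
  qed
  have le': "(LINT x:{0<..<1}|lebesgue. (int_after T u (s, x) - int_after T u (t, x))\<^sup>2) \<le> \<bar>s - t\<bar> * ?C" for s t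
    using le[of s t] le[of t s] by (cases "s \<le> t") (auto simp: power2_commute)
  have lim: "((\<lambda>s. LINT x:{0<..<1}|lebesgue. (int_after T u (s, x) - int_after T u (t, x))\<^sup>2) \<longlongrightarrow> 0) (at t within X)" for t X
  proof (rule tendsto_sandwich[OF _ _ tendsto_const])
    have "((\<lambda>s. \<bar>s - t\<bar> * ?C) \<longlongrightarrow> \<bar>t - t\<bar> * ?C) (at t within X)" by (intro tendsto_intros)
    then show "((\<lambda>s. \<bar>s - t\<bar> * ?C) \<longlongrightarrow> 0) (at t within X)" by simp
  qed (use le' in \<open>auto simp: set_lebesgue_integral_def intro!: always_eventually\<close>)
  have "L2_int 0 1 (\<lambda>x. int_after T u (t, x))" for t
    using L[of t] L2fun_measurable[OF L[of t]] by (subst L2_int_iff) auto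
  with lim show ?thesis by (simp add: cont_H_def)
qed

text \<open>A weak derivative is a family of linear identities, and each survives integration over
  later times once Fubini has exchanged that integral with the pairing in \<open>x\<close>. The null
  set of exceptional times disappears under the integral, so the conclusion holds for every
  \<open>t\<close>.\<close>

lemma int_after_weak_deriv:
  assumes u: "L2fun (leb_Q T) u" and ux: "L2fun (leb_Q T) ux"
    and wd: "AE t in leb_on {0<..<T}. weak_deriv_on 0 1 (\<lambda>x. u (t, x)) (\<lambda>x. ux (t, x))"
  shows "weak_deriv_on 0 1 (\<lambda>x. int_after T u (t, x)) (\<lambda>x. int_after T ux (t, x))"
proof -
  let ?M = "leb_on {0<..<T}" and ?N = "leb_on {0<..<1::real}"
  interpret M: finite_measure ?M by (rule finite_measure_leb_on_interval)
  interpret N: finite_measure ?N by (rule finite_measure_leb_on_interval)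
  interpret pair_sigma_finite ?M ?N by (rule finite_pair_sigma_finite) unfold_locales
  note MN = M.finite_measure_axioms N.finite_measure_axioms
  note [measurable] = L2fun_measurable[OF u] L2fun_measurable[OF ux]
  have L: "L2fun ?N (\<lambda>x. int_after T w (t, x))" if "L2fun (leb_Q T) w" for w
    unfolding int_after_def using time_integral_L2(1)[OF that, of "{t<..}"] by simp
  have swap: "(\<integral>x. int_after T w (t, x) * k x \<partial>?N) = (\<integral>s. indicator {t<..} s * (\<integral>x. w (s, x) * k x \<partial>?N) \<partial>?M)"
    if w: "L2fun (leb_Q T) w" and [measurable]: "k \<in> borel_measurable borel" and k: "\<And>x. \<bar>k x\<bar> \<le> C" for w k C
  proof -
    note [measurable] = L2fun_measurable[OF w]
    have "L2fun (leb_Q T) (\<lambda>z. indicator {t<..} (fst z) * w z)"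
      by (rule L2fun_bounded_mult[OF w, of _ 1]) (auto simp: indicator_def)
    then have "L2fun (leb_Q T) (\<lambda>z. k (snd z) * (indicator {t<..} (fst z) * w z))"
      by (rule L2fun_bounded_mult[of _ _ _ C]) (use k in auto)
    then have "integrable (leb_Q T) (\<lambda>z. k (snd z) * (indicator {t<..} (fst z) * w z))"
      using finite_measure.L2fun_integrable[OF finite_measure_pair_measure] MN by blast
    then have "integrable (leb_Q T) (\<lambda>(s, x). indicator {t<..} s * w (s, x) * k x)"
      by (simp add: case_prod_beta' mult_ac)
    from Fubini_integral[OF this]
    have "(\<integral>x. int_after T w (t, x) * k x \<partial>?N) = (\<integral>s. (\<integral>x. indicator {t<..} s * w (s, x) * k x \<partial>?N) \<partial>?M)"
      by (simp add: int_after_def)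
    also have "\<dots> = (\<integral>s. indicator {t<..} s * (\<integral>x. w (s, x) * k x \<partial>?N) \<partial>?M)"
      by (simp add: mult.assoc)
    finally show ?thesis .
  qed
  have "(\<integral>x. int_after T u (t, x) * deriv \<phi> x \<partial>?N) = - (\<integral>x. int_after T ux (t, x) * \<phi> x \<partial>?N)"
    if \<phi>: "test_fun 0 1 \<phi>" for \<phi>
  proof -
    note [measurable] = test_fun_measurable[OF \<phi>]
    obtain C where C: "\<And>x. \<bar>\<phi> x\<bar> \<le> C" "\<And>x. \<bar>deriv \<phi> x\<bar> \<le> C" using test_fun_bounded[OF \<phi>] by blast
    have "(\<integral>x. int_after T u (t, x) * deriv \<phi> x \<partial>?N) = (\<integral>s. indicator {t<..} s * (\<integral>x. u (s, x) * deriv \<phi> x \<partial>?N) \<partial>?M)"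
      by (rule swap[OF u _ C(2)]) simp
    also have "\<dots> = (\<integral>s. - (indicator {t<..} s * (\<integral>x. ux (s, x) * \<phi> x \<partial>?N)) \<partial>?M)"
    proof (intro integral_cong_AE)
      show "AE s in ?M. indicator {t<..} s * (\<integral>x. u (s, x) * deriv \<phi> x \<partial>?N) = - (indicator {t<..} s * (\<integral>x. ux (s, x) * \<phi> x \<partial>?N))"
        using wd
      proof eventually_elim
        case (elim s)
        have "(\<lambda>x. u (s, x)) \<in> borel_measurable borel" "(\<lambda>x. ux (s, x)) \<in> borel_measurable borel" by measurable
        from weak_deriv_on_iff[OF this] elim \<phi> show ?case by auto
      qed
    qed measurable
    also have "\<dots> = - (\<integral>s. indicator {t<..} s * (\<integral>x. ux (s, x) * \<phi> x \<partial>?N) \<partial>?M)" by simp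
    also have "\<dots> = - (\<integral>x. int_after T ux (t, x) * \<phi> x \<partial>?N)"
      by (subst swap[OF ux _ C(1)]) simp_all
    finally show ?thesis .
  qed
  with L[OF u] L[OF ux] show ?thesis
    by (subst weak_deriv_on_iff[OF _ _ AE_I2 AE_I2, OF _ _ refl refl])
       (auto intro: N.L2fun_integrable dest: L2fun_measurable)
qed

text \<open>By \<open>triangle_swap_fst\<close> the primitive passes to \<open>deriv \<phi>\<close>,
  and the integral of \<open>deriv \<phi>\<close> over earlier times is \<phi> because \<phi>
  vanishes at 0.\<close>

lemma int_after_weak_time_deriv:
  assumes u: "L2fun (leb_Q T) u"
  shows "W12_H_with T (\<lambda>t x. int_after T u (t, x)) (\<lambda>t x. - u (t, x))"
proof -
  let ?M = "leb_on {0<..<T}" and ?N = "leb_on {0<..<1::real}"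
  interpret M: finite_measure ?M by (rule finite_measure_leb_on_interval)
  interpret N: finite_measure ?N by (rule finite_measure_leb_on_interval)
  interpret pair_sigma_finite ?M ?N by (rule finite_pair_sigma_finite) unfold_locales
  note MN = M.finite_measure_axioms N.finite_measure_axioms
  note ua = L2fun_int_after[OF u]
  have [measurable]: "u \<in> borel_measurable (borel \<Otimes>\<^sub>M borel)"
    "int_after T u \<in> borel_measurable (borel \<Otimes>\<^sub>M borel)"
    using L2fun_measurable[OF u] L2fun_measurable[OF ua] by (simp_all add: leb_on_Qset borel_prod)
  have L: "L2_Q T (\<lambda>t x. int_after T u (t, x))" "L2_Q T (\<lambda>t x. - u (t, x))"
    using L2_Q_of_L2fun[OF ua] L2_Q_of_L2fun[OF L2fun_cmult[OF u, of "-1"]] by simp_all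
  have "(LINT z:Qset T|lebesgue. unc (\<lambda>t x. int_after T u (t, x)) z * deriv \<phi> (fst z) * \<psi>0 (snd z))
     = - (LINT z:Qset T|lebesgue. unc (\<lambda>t x. - u (t, x)) z * \<phi> (fst z) * \<psi>0 (snd z))"
    if \<phi>: "test_fun 0 T \<phi>" and \<psi>0: "L2_int 0 1 \<psi>0" for \<phi> \<psi>0
  proof -
    have [measurable]: "\<phi> \<in> borel_measurable borel" "deriv \<phi> \<in> borel_measurable borel"
      by (rule test_fun_measurable[OF \<phi>])+
    obtain C where C: "\<And>x. \<bar>\<phi> x\<bar> \<le> C" "\<And>x. \<bar>deriv \<phi> x\<bar> \<le> C" using test_fun_bounded[OF \<phi>] by blast
    \<comment> \<open>\<open>\<psi>0\<close> is only Lebesgue measurable; with a Borel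
      representative the integrand on the product is Borel, as the swap requires.\<close>
    obtain \<psi> where \<psi> [measurable]: "\<psi> \<in> borel_measurable borel" and ae: "AE x in ?N. \<psi>0 x = \<psi> x"
      using leb_on_borel_rep[of "{0<..<1}" \<psi>0] \<psi>0 unfolding L2_int_def by auto
    have L\<psi>: "L2fun ?N \<psi>" using \<psi>0 L2_int_iff[OF \<psi> ae] by simp
    have aeQ: "AE z in leb_on (Qset T). \<psi>0 (snd z) = \<psi> (snd z)"
      using AE_pair_snd[OF MN ae] unfolding leb_on_Qset .
    have f: "L2fun (leb_Q T) (\<lambda>z. deriv \<phi> (fst z) * \<psi> (snd z))"
      by (rule L2fun_bounded_mult[OF L2fun_snd[OF MN L\<psi>], of _ C]) (use C in auto)
    have "(LINT z:Qset T|lebesgue. unc (\<lambda>t x. int_after T u (t, x)) z * deriv \<phi> (fst z) * \<psi>0 (snd z))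
      = (\<integral>z. deriv \<phi> (fst z) * \<psi> (snd z) * int_after T u z \<partial>leb_on (Qset T))"
    proof (rule set_lebesgue_integral_leb_on)
      show "(\<lambda>z. deriv \<phi> (fst z) * \<psi> (snd z) * int_after T u z) \<in> borel_measurable borel"
        by (simp add: borel_prod[symmetric])
      show "AE z in leb_on (Qset T). unc (\<lambda>t x. int_after T u (t, x)) z * deriv \<phi> (fst z) * \<psi>0 (snd z)
        = deriv \<phi> (fst z) * \<psi> (snd z) * int_after T u z"
        using aeQ by eventually_elim (simp add: unc_def)
    qed simp
    also have "\<dots> = (\<integral>z. u z * (\<integral>s. indicator {..<fst z} s * (deriv \<phi> s * \<psi> (snd z)) \<partial>?M) \<partial>leb_Q T)"
      using triangle_swap_fst[OF MN _ f u] by (simp add: int_after_def leb_on_Qset)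
    also have "\<dots> = (\<integral>z. u z * \<phi> (fst z) * \<psi> (snd z) \<partial>leb_on (Qset T))"
      unfolding leb_on_Qset
    proof (intro integral_cong_AE)
      show "AE z in leb_on (Qset T). u z * (\<integral>s. indicator {..<fst z} s * (deriv \<phi> s * \<psi> (snd z)) \<partial>?M)
        = u z * \<phi> (fst z) * \<psi> (snd z)"
        using AE_leb_on_mem[OF Qset_borel]
      proof eventually_elim
        case (elim z)
        then have "(\<integral>s. indicator {..<fst z} s * deriv \<phi> s \<partial>?M) = \<phi> (fst z)"
          by (intro test_fun_integral[OF \<phi>]) (auto simp: Qset_def)
        then show ?case by (simp flip: mult.assoc)
      qed
    qed (simp_all add: borel_prod[symmetric] lessThan_def)
    also have "\<dots> = - (\<integral>z. - u z * \<phi> (fst z) * \<psi> (snd z) \<partial>leb_on (Qset T))" by simp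
    also have "(\<integral>z. - u z * \<phi> (fst z) * \<psi> (snd z) \<partial>leb_on (Qset T))
      = (LINT z:Qset T|lebesgue. unc (\<lambda>t x. - u (t, x)) z * \<phi> (fst z) * \<psi>0 (snd z))"
    proof (rule set_lebesgue_integral_leb_on[symmetric])
      show "(\<lambda>z. - u z * \<phi> (fst z) * \<psi> (snd z)) \<in> borel_measurable borel"
        by (simp add: borel_prod[symmetric])
      show "AE z in leb_on (Qset T). unc (\<lambda>t x. - u (t, x)) z * \<phi> (fst z) * \<psi>0 (snd z)
        = - u z * \<phi> (fst z) * \<psi> (snd z)"
        using aeQ by eventually_elim (simp add: unc_def)
    qed simp
    finally show ?thesis .
  qed
  with L show ?thesis by (simp add: W12_H_with_def)
qed

lemma int_after_L2_X_with:
  assumes u: "L2fun (leb_Q T) u" and ux: "L2fun (leb_Q T) ux"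
    and wd: "AE t in leb_on {0<..<T}. weak_deriv_on 0 1 (\<lambda>x. u (t, x)) (\<lambda>x. ux (t, x))"
  shows "L2_X_with T (\<lambda>t x. int_after T u (t, x)) (\<lambda>t x. int_after T ux (t, x))"
  using int_after_weak_deriv[OF assms] L2_Q_of_L2fun L2fun_int_after u ux by (simp add: L2_X_with_def)

lemma int_after_end: "int_after T u (T, x) = 0"
proof -
  have "AE s in leb_on {0<..<T}. indicator {T<..} s * u (s, x) = 0"
    using AE_leb_on_interval[of 0 T] by eventually_elim (auto simp: indicator_def)
  then show ?thesis unfolding int_after_def by (simp add: integral_eq_zero_AE)
qed

section \<open>Estimates on time slices and the Gronwall lemma\<close>

lemma no_atoms_leb_on: "AE s in leb_on {a<..<b::real}. s \<noteq> t"
  by (simp add: AE_leb_on) (metis (mono_tags, lifting) AE_completion AE_lborel_singleton eventually_mono)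

text \<open>\<open>A\<close> is bounded and Borel but not known to be continuous, and
  \<open>k\<close> is merely integrable, so a continuation argument is used: beyond the last time
  \<sigma> before which \<open>A\<close> vanishes there is a window on which \<open>k\<close> has
  mass below 1/2, and up to its end the inequality bounds the supremum of \<open>A\<close> by half
  of itself.\<close>

lemma Gronwall_leb_on:
  fixes A k :: "real \<Rightarrow> real"
  assumes [measurable]: "A \<in> borel_measurable borel" and k: "integrable (leb_on {0<..<T}) k"
    and k0: "\<And>t. 0 \<le> k t" and A0: "\<And>t. 0 \<le> A t" and AC: "\<And>t. A t \<le> C"
    and le: "\<And>\<tau>. A \<tau> \<le> (\<integral>t. indicator {..<\<tau>} t * (k t * A t) \<partial>leb_on {0<..<T})"
  shows "A \<tau> = 0"
proof (rule ccontr)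
  let ?M = "leb_on {0<..<T}"
  assume nz: "A \<tau> \<noteq> 0"
  have [measurable]: "k \<in> borel_measurable borel" using borel_measurable_integrable[OF k] by simp
  \<comment> \<open>The strict inequality leaves the value at the supremum open, which is harmless
    since one point has no mass. \<open>0 \<in> Z\<close> because the measure lives on (0,T), and
    \<tau> bounds \<open>Z\<close> because \<open>A \<tau> \<noteq> 0\<close>.\<close>
  define Z where "Z = {\<tau>. \<forall>s<\<tau>. A s = 0}"
  have "A s = 0" if "s < 0" for s
  proof -
    have "(\<integral>t. indicator {..<s} t * (k t * A t) \<partial>?M) = 0"
      by (intro integral_eq_zero_AE, use AE_leb_on_interval[of 0 T] in eventually_elim)
         (use that in \<open>auto simp: indicator_def\<close>)
    with le[of s] A0[of s] show ?thesis by simp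
  qed
  then have "0 \<in> Z" by (auto simp: Z_def)
  have bdd: "bdd_above Z"
    by (rule bdd_aboveI[of _ \<tau>]) (use nz in \<open>force simp: Z_def\<close>)
  define \<sigma> where "\<sigma> = Sup Z"
  have \<sigma>: "A s = 0" if "s < \<sigma>" for s
    using that less_cSup_iff[of Z s] \<open>0 \<in> Z\<close> bdd unfolding \<sigma>_def by (auto simp: Z_def)
  \<comment> \<open>The windows exclude \<sigma> and shrink to the empty set, so the mass of
    \<open>k\<close> on them tends to 0.\<close>
  have "(\<lambda>n. \<integral>t. indicator {\<sigma><..<\<sigma> + 1 / Suc n} t * k t \<partial>?M) \<longlonglongrightarrow> (\<integral>t. 0 \<partial>?M)"
  proof (rule integral_dominated_convergence[where w=k])
    show "AE t in ?M. (\<lambda>n. indicator {\<sigma><..<\<sigma> + 1 / Suc n} t * k t) \<longlonglongrightarrow> 0"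
    proof (rule AE_I2)
      fix t
      have "(\<lambda>n. \<sigma> + 1 / Suc n) \<longlonglongrightarrow> \<sigma> + 0" 
        by (intro tendsto_intros LIMSEQ_inverse_real_of_nat[unfolded inverse_eq_divide])
      then have lt: "eventually (\<lambda>n. \<sigma> + 1 / Suc n < t) sequentially" if "\<sigma> < t"
        using that by (intro order_tendstoD(2)[where y=\<sigma>]) auto
      have "eventually (\<lambda>n. indicator {\<sigma><..<\<sigma> + 1 / Suc n} t * k t = 0) sequentially"
      proof (cases "\<sigma> < t")
        case True
        from lt[OF True] show ?thesis by eventually_elim (simp add: indicator_def)
      qed (simp add: indicator_def)
      then show "(\<lambda>n. indicator {\<sigma><..<\<sigma> + 1 / Suc n} t * k t) \<longlonglongrightarrow> 0" by (rule tendsto_eventually)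
    qed
  qed (use k k0 in \<open>auto simp: indicator_def\<close>)
  then have "eventually (\<lambda>n. (\<integral>t. indicator {\<sigma><..<\<sigma> + 1 / Suc n} t * k t \<partial>?M) < 1/2) sequentially"
    by (intro order_tendstoD(2)[where y=0]) auto
  then obtain n where n: "(\<integral>t. indicator {\<sigma><..<\<sigma> + 1 / Suc n} t * k t \<partial>?M) < 1/2"
    by (auto simp: eventually_sequentially)
  define d where "d = 1 / real (Suc n)"
  have d: "d > 0" "(\<integral>t. indicator {\<sigma><..<\<sigma> + d} t * k t \<partial>?M) < 1/2" using n by (auto simp: d_def)
  define m where "m = (SUP s\<in>{..<\<sigma> + d}. A s)"
  have bA: "bdd_above (A ` {..<\<sigma> + d})" using AC by (intro bdd_aboveI[of _ C]) auto
  have Am: "A s \<le> m" if "s < \<sigma> + d" for s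
    unfolding m_def by (rule cSUP_upper[OF _ bA]) (use that in auto)
  have m0: "0 \<le> m" using A0 Am[of \<sigma>] d(1) by (metis less_add_same_cancel1 order_trans)
  have "A s \<le> m / 2" if s: "s < \<sigma> + d" for s
  proof -
    have i: "integrable ?M (\<lambda>t. indicator {\<sigma><..<\<sigma> + d} t * k t)"
      by (rule Bochner_Integration.integrable_bound[OF k]) (auto simp: indicator_def)
    have i2: "integrable ?M (\<lambda>t. indicator {..<s} t * (k t * A t))"
      by (rule Bochner_Integration.integrable_bound[OF integrable_mult_left[OF k, of C]])
         (use A0 AC k0 in \<open>auto simp: indicator_def abs_mult intro!: mult_left_mono order_trans[OF AC abs_ge_self]\<close>)
    have "A s \<le> (\<integral>t. indicator {..<s} t * (k t * A t) \<partial>?M)" by (rule le)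
    also have "\<dots> \<le> (\<integral>t. indicator {\<sigma><..<\<sigma> + d} t * k t * m \<partial>?M)"
    proof (rule integral_mono_AE[OF i2 integrable_mult_left[OF i]])
      \<comment> \<open>Times before \<sigma> contribute nothing, \<sigma> itself is null, and the
        remaining times below \<open>s\<close> lie in the window, where
        \<open>A t \<le> m\<close>.\<close>
      show "AE t in ?M. indicator {..<s} t * (k t * A t) \<le> indicator {\<sigma><..<\<sigma> + d} t * k t * m"
        using no_atoms_leb_on[where t=\<sigma> and a=0 and b=T]
      proof eventually_elim
        case (elim t)
        then show ?case using s k0[of t] \<sigma>[of t] Am[of t] m0
          by (auto simp: indicator_def intro!: mult_left_mono mult_nonneg_nonneg)
      qed
    qed
    also have "\<dots> = (\<integral>t. indicator {\<sigma><..<\<sigma> + d} t * k t \<partial>?M) * m" by simp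
    also have "\<dots> \<le> (1/2) * m" using d m0 by (intro mult_right_mono) auto
    finally show ?thesis by simp
  qed
  then have "m \<le> m / 2" unfolding m_def by (intro cSUP_least) auto
  with m0 have "m = 0" by simp
  with Am A0 have "A s = 0" if "s < \<sigma> + d" for s using that by (metis antisym)
  then have "\<sigma> + d \<in> Z" by (auto simp: Z_def)
  with bdd have "\<sigma> + d \<le> \<sigma>" unfolding \<sigma>_def by (rule cSup_upper[rotated])
  with d show False by simp
qed

text \<open>\<open>G\<close> is a primitive of \<open>w\<close> vanishing at 1, so
  \<open>(G y)\<^sup>2\<close> is minus twice the integral of \<open>w * G\<close> over
  \<open>x > y\<close>. The weight \<epsilon> turns the product of the two norms into a sum; leaving
  it free avoids square roots and defers its choice to \<open>slice_estimate\<close>.\<close>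

lemma indefinite_integral_sup_bound:
  fixes w G :: "real \<Rightarrow> real"
  assumes w: "L2fun (leb_on {0<..<1}) w" and G: "L2fun (leb_on {0<..<1}) G"
    and Gw: "AE y in leb_on {0<..<1}. G y = - (\<integral>x. indicator {y<..} x * w x \<partial>leb_on {0<..<1})"
    and \<epsilon>: "\<epsilon> > 0"
  shows "AE y in leb_on {0<..<1}. (G y)\<^sup>2 \<le> \<epsilon> * (\<integral>x. (w x)\<^sup>2 \<partial>leb_on {0<..<1}) + (\<integral>x. (G x)\<^sup>2 \<partial>leb_on {0<..<1}) / \<epsilon>"
  using Gw
proof eventually_elim
  case (elim y)
  let ?N = "leb_on {0<..<1::real}"
  interpret N: finite_measure ?N by (rule finite_measure_leb_on_interval)
  have [measurable]: "w \<in> borel_measurable borel" "G \<in> borel_measurable borel"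
    using L2fun_measurable[OF w] L2fun_measurable[OF G] by simp_all
  let ?f = "\<lambda>x. indicator {y<..} x * w x"
  have f: "L2fun ?N ?f" by (rule L2fun_indicator_mult[OF w]) simp
  have yG: "L2fun ?N (\<lambda>x. indicator {y<..} x * G x)" by (rule L2fun_indicator_mult[OF G]) simp
  have "(G y)\<^sup>2 = (\<integral>x. ?f x \<partial>?N)\<^sup>2" using elim by simp
  \<comment> \<open>This is the chain rule for the square, with \<open>?f\<close> integrated against
    its own primitive; for \<open>x > y\<close> the inner integral is \<open>- G x\<close> by
    \<open>Gw\<close>.\<close>
  also have "\<dots> = 2 * (\<integral>x. ?f x * (\<integral>s. indicator {x<..} s * ?f s \<partial>?N) \<partial>?N)"
    using triangle_square(2)[OF N.finite_measure_axioms _ N.L2fun_integrable[OF f] no_atoms_leb_on] by simp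
  also have "(\<integral>x. ?f x * (\<integral>s. indicator {x<..} s * ?f s \<partial>?N) \<partial>?N) = (\<integral>x. - (w x * (indicator {y<..} x * G x)) \<partial>?N)"
  proof (intro integral_cong_AE)
    show "AE x in ?N. ?f x * (\<integral>s. indicator {x<..} s * ?f s \<partial>?N) = - (w x * (indicator {y<..} x * G x))"
      using Gw
    proof eventually_elim
      case (elim x)
      have "(\<integral>s. indicator {x<..} s * ?f s \<partial>?N) = (\<integral>s. indicator {x<..} s * w s \<partial>?N)" if "y < x"
        using that by (intro Bochner_Integration.integral_cong) (auto simp: indicator_def)
      with elim show ?case by (cases "y < x") (auto simp: indicator_def)
    qed
  qed (simp_all add: greaterThan_def)
  also have "2 * \<dots> = (\<integral>x. - 2 * (w x * (indicator {y<..} x * G x)) \<partial>?N)" by simp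
  also have "\<dots> \<le> (\<integral>x. \<epsilon> * (w x)\<^sup>2 + (G x)\<^sup>2 / \<epsilon> \<partial>?N)"
  proof (rule integral_mono)
    show "integrable ?N (\<lambda>x. - 2 * (w x * (indicator {y<..} x * G x)))"
      by (intro integrable_mult_right L2fun_mult_integrable[OF w yG])
    show "integrable ?N (\<lambda>x. \<epsilon> * (w x)\<^sup>2 + (G x)\<^sup>2 / \<epsilon>)"
      using L2fun_square[OF w] L2fun_square[OF G] by auto
    fix x
    have "0 \<le> (\<epsilon> * w x + indicator {y<..} x * G x)\<^sup>2" by simp
    then have "- 2 * \<epsilon> * (w x * (indicator {y<..} x * G x)) \<le> \<epsilon>\<^sup>2 * (w x)\<^sup>2 + (indicator {y<..} x * G x)\<^sup>2"
      by (simp add: power2_sum power_mult_distrib)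
    also have "\<dots> \<le> \<epsilon>\<^sup>2 * (w x)\<^sup>2 + (G x)\<^sup>2" by (auto simp: indicator_def)
    finally show "- 2 * (w x * (indicator {y<..} x * G x)) \<le> \<epsilon> * (w x)\<^sup>2 + (G x)\<^sup>2 / \<epsilon>"
      using \<epsilon> by (simp add: field_simps power2_eq_square)
  qed
  also have "\<dots> = \<epsilon> * (\<integral>x. (w x)\<^sup>2 \<partial>?N) + (\<integral>x. (G x)\<^sup>2 \<partial>?N) / \<epsilon>"
    using L2fun_square[OF w] L2fun_square[OF G] by simp
  finally show ?case .
qed

text \<open>Young's inequality splits \<open>R * G\<close> into a part with
  \<open>(V x)\<^sup>2\<close> and a part with \<open>(p x)\<^sup>2 * (G x)\<^sup>2\<close>; a
  uniform bound \<open>S\<close> of \<open>(G x)\<^sup>2\<close> then reduces the latter to the norm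
  of \<open>p\<close>. But \<open>S\<close> involves the norm of \<open>w\<close>, hence of
  \<open>V\<close>, which must be reabsorbed. Each of the two steps spends
  \<open>\<delta> / 2\<close>, and the total \<delta> is what the monotonicity of h can pay
  for.\<close>

lemma slice_estimate:
  fixes w G V p R :: "real \<Rightarrow> real"
  assumes w: "L2fun (leb_on {0<..<1}) w" and G: "L2fun (leb_on {0<..<1}) G"
    and V: "L2fun (leb_on {0<..<1}) V" and p: "L2fun (leb_on {0<..<1}) p"
    and [measurable]: "R \<in> borel_measurable borel"
    and Gw: "AE y in leb_on {0<..<1}. G y = - (\<integral>x. indicator {y<..} x * w x \<partial>leb_on {0<..<1})"
    and wV: "\<And>x. \<bar>w x\<bar> \<le> Ch * \<bar>V x\<bar>" and RV: "\<And>x. \<bar>R x\<bar> \<le> Cb * \<bar>V x\<bar> * \<bar>p x\<bar>"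
    and pos: "\<delta> > 0" "Ch > 0" "Cb > 0"
  shows "integrable (leb_on {0<..<1}) (\<lambda>x. R x * G x)"
    and "(\<integral>x. \<bar>R x * G x\<bar> \<partial>leb_on {0<..<1}) \<le> \<delta> * (\<integral>x. (V x)\<^sup>2 \<partial>leb_on {0<..<1})
      + Cb^4 * Ch\<^sup>2 / (2 * \<delta>^3) * (\<integral>x. (p x)\<^sup>2 \<partial>leb_on {0<..<1})\<^sup>2 * (\<integral>x. (G x)\<^sup>2 \<partial>leb_on {0<..<1})"
proof -
  let ?N = "leb_on {0<..<1::real}"
  define n q a where "n = (\<integral>x. (V x)\<^sup>2 \<partial>?N)" and "q = (\<integral>x. (p x)\<^sup>2 \<partial>?N)" and "a = (\<integral>x. (G x)\<^sup>2 \<partial>?N)"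
  have nn: "n \<ge> 0" "q \<ge> 0" "a \<ge> 0" by (simp_all add: n_def q_def a_def)
  have [measurable]: "w \<in> borel_measurable borel" "G \<in> borel_measurable borel"
    "V \<in> borel_measurable borel" "p \<in> borel_measurable borel"
    using L2fun_measurable[OF w] L2fun_measurable[OF G] L2fun_measurable[OF V] L2fun_measurable[OF p] by simp_all
  have w2: "(\<integral>x. (w x)\<^sup>2 \<partial>?N) \<le> Ch\<^sup>2 * n"
  proof -
    have "(\<integral>x. (w x)\<^sup>2 \<partial>?N) \<le> (\<integral>x. Ch\<^sup>2 * (V x)\<^sup>2 \<partial>?N)"
    proof (rule integral_mono)
      show "(w x)\<^sup>2 \<le> Ch\<^sup>2 * (V x)\<^sup>2" for x
        using power_mono[OF wV[of x], of 2] by (simp add: power_mult_distrib)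
    qed (use L2fun_square[OF w] L2fun_square[OF V] in auto)
    then show ?thesis by (simp add: n_def)
  qed
  have bound: "integrable ?N (\<lambda>x. R x * G x) \<and>
    (\<integral>x. \<bar>R x * G x\<bar> \<partial>?N) \<le> \<delta> / 2 * n + Cb\<^sup>2 / (2 * \<delta>) * (\<epsilon> * (Ch\<^sup>2 * n) + a / \<epsilon>) * q" if \<epsilon>: "\<epsilon> > 0" for \<epsilon>
  proof -
    define S where "S = \<epsilon> * (Ch\<^sup>2 * n) + a / \<epsilon>"
    have GS: "AE y in ?N. (G y)\<^sup>2 \<le> S"
      using indefinite_integral_sup_bound[OF w G Gw \<epsilon>]
    proof eventually_elim
      case (elim y)
      also have "\<epsilon> * (\<integral>x. (w x)\<^sup>2 \<partial>?N) \<le> \<epsilon> * (Ch\<^sup>2 * n)" using w2 \<epsilon> by (intro mult_left_mono) auto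
      finally show ?case by (simp add: S_def a_def)
    qed
    have b: "AE x in ?N. \<bar>R x * G x\<bar> \<le> \<delta> / 2 * (V x)\<^sup>2 + Cb\<^sup>2 / (2 * \<delta>) * S * (p x)\<^sup>2"
      using GS
    proof eventually_elim
      case (elim x)
      have "\<bar>R x * G x\<bar> \<le> \<bar>V x\<bar> * (Cb * \<bar>p x\<bar> * \<bar>G x\<bar>)"
        using mult_right_mono[OF RV[of x], of "\<bar>G x\<bar>"] by (simp add: abs_mult mult_ac)
      also have "\<dots> \<le> \<delta> / 2 * (V x)\<^sup>2 + Cb\<^sup>2 / (2 * \<delta>) * (p x)\<^sup>2 * (G x)\<^sup>2"
      proof -
        \<comment> \<open>The weight \<delta> on \<open>V\<close> is chosen so that division by
          \<open>2 * \<delta>\<close> leaves the coefficient \<open>\<delta> / 2\<close>, half of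
          the available amount.\<close>
        have "0 \<le> (\<delta> * \<bar>V x\<bar> - Cb * \<bar>p x\<bar> * \<bar>G x\<bar>)\<^sup>2" by simp
        then have "2 * \<delta> * (\<bar>V x\<bar> * (Cb * \<bar>p x\<bar> * \<bar>G x\<bar>)) \<le> \<delta>\<^sup>2 * (V x)\<^sup>2 + Cb\<^sup>2 * (p x)\<^sup>2 * (G x)\<^sup>2"
          by (simp add: power2_diff power_mult_distrib mult_ac)
        then show ?thesis using pos by (simp add: field_simps power2_eq_square)
      qed
      also have "\<dots> \<le> \<delta> / 2 * (V x)\<^sup>2 + Cb\<^sup>2 / (2 * \<delta>) * (p x)\<^sup>2 * S"
        using elim pos by (intro add_left_mono mult_left_mono) auto
      finally show ?case by (simp add: mult_ac)
    qed
    have i: "integrable ?N (\<lambda>x. \<delta> / 2 * (V x)\<^sup>2 + Cb\<^sup>2 / (2 * \<delta>) * S * (p x)\<^sup>2)"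
      using L2fun_square[OF V] L2fun_square[OF p] by auto
    have i': "integrable ?N (\<lambda>x. R x * G x)"
      by (rule Bochner_Integration.integrable_bound[OF i]) (simp, use b in eventually_elim, simp)
    have "(\<integral>x. \<bar>R x * G x\<bar> \<partial>?N) \<le> (\<integral>x. \<delta> / 2 * (V x)\<^sup>2 + Cb\<^sup>2 / (2 * \<delta>) * S * (p x)\<^sup>2 \<partial>?N)"
      using i i' b by (intro integral_mono_AE) auto
    also have "\<dots> = \<delta> / 2 * n + Cb\<^sup>2 / (2 * \<delta>) * S * q"
      using L2fun_square[OF V] L2fun_square[OF p] by (simp add: n_def q_def)
    finally show ?thesis using i' by (simp add: S_def)
  qed
  from bound[of 1] show "integrable ?N (\<lambda>x. R x * G x)" by simp
  have "(\<integral>x. \<bar>R x * G x\<bar> \<partial>?N) \<le> \<delta> * n + Cb^4 * Ch\<^sup>2 / (2 * \<delta>^3) * q\<^sup>2 * a"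
  \<comment> \<open>The \<epsilon> chosen in the second case divides by \<open>q\<close>. For
    \<open>q = 0\<close> the last term of \<open>bound\<close> vanishes and any positive \<epsilon>
    serves.\<close>
  proof (cases "q = 0")
    case True
    have "\<delta> / 2 * n \<le> \<delta> * n" using pos nn by simp
    then show ?thesis using bound[of 1] True by simp
  next
    case False
    then have q: "q > 0" using nn by simp
    \<comment> \<open>with this \<epsilon> the term in n costs exactly the other half of the \<delta> * n available\<close>
    define \<epsilon> where "\<epsilon> = \<delta>\<^sup>2 / (Cb\<^sup>2 * Ch\<^sup>2 * q)"
    have \<epsilon>: "\<epsilon> > 0" using q pos by (simp add: \<epsilon>_def)
    have "Cb\<^sup>2 / (2 * \<delta>) * (\<epsilon> * (Ch\<^sup>2 * n) + a / \<epsilon>) * q = \<delta> / 2 * n + Cb^4 * Ch\<^sup>2 / (2 * \<delta>^3) * q\<^sup>2 * a"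
      using q pos unfolding \<epsilon>_def by (simp add: field_simps eval_nat_numeral)
    then show ?thesis using bound[OF \<epsilon>] by simp
  qed
  then show "(\<integral>x. \<bar>R x * G x\<bar> \<partial>?N) \<le> \<delta> * (\<integral>x. (V x)\<^sup>2 \<partial>?N)
      + Cb^4 * Ch\<^sup>2 / (2 * \<delta>^3) * (\<integral>x. (p x)\<^sup>2 \<partial>?N)\<^sup>2 * (\<integral>x. (G x)\<^sup>2 \<partial>?N)"
    by (simp add: n_def q_def a_def)
qed

section \<open>The equation for the difference of two solutions\<close>

lemma finite_measure_leb_Q: "finite_measure (leb_Q T)"
  by (intro finite_measure_pair_measure finite_measure_leb_on_interval)

text \<open>The time derivative \<open>- \<theta>\<close> of the test function
  \<open>int_after T \<theta>\<close> makes the first term positive. The right-hand side depends on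
  \<open>v0\<close> and \<theta> alone, so it is the same for two solutions. \<open>p'\<close> is
  fixed from outside in order that both equations contain the same representative of
  \<open>p\<close>.\<close>

lemma weak_solution_borelE:
  fixes p' :: "real \<times> real \<Rightarrow> real"
  assumes sol: "weak_solution h b T p v0 v"
    and hb [measurable]: "h \<in> borel_measurable borel" "b \<in> borel_measurable borel"
    and p' [measurable]: "p' \<in> borel_measurable borel" and pp': "AE z in leb_on (Qset T). unc p z = p' z"
  obtains u ux where "L2fun (leb_Q T) u" "L2fun (leb_Q T) ux" "AE z in leb_on (Qset T). unc v z = u z"
    "AE t in leb_on {0<..<T}. weak_deriv_on 0 1 (\<lambda>x. u (t, x)) (\<lambda>x. ux (t, x))"
    "\<And>\<theta> \<theta>x. L2fun (leb_Q T) \<theta> \<Longrightarrow> L2fun (leb_Q T) \<theta>x \<Longrightarrow>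
       AE t in leb_on {0<..<T}. weak_deriv_on 0 1 (\<lambda>x. \<theta> (t, x)) (\<lambda>x. \<theta>x (t, x)) \<Longrightarrow>
       (\<integral>z. h (u z) * \<theta> z \<partial>leb_Q T) + (\<integral>z. (ux z + b (u z) * p' z) * int_after T \<theta>x z \<partial>leb_Q T)
       = (LINT x:{0<..<1}|lebesgue. h (v0 x) * int_after T \<theta> (0, x))"
proof -
  let ?M = "leb_on {0<..<T}" and ?N = "leb_on {0<..<1::real}"
  interpret M: finite_measure ?M by (rule finite_measure_leb_on_interval)
  interpret N: finite_measure ?N by (rule finite_measure_leb_on_interval)
  interpret pair_sigma_finite ?M ?N by (rule finite_pair_sigma_finite) unfold_locales
  obtain vx where vx: "L2_X_with T v vx"
    and test: "\<And>\<eta> \<eta>x \<eta>t. W12_H_with T \<eta> \<eta>t \<Longrightarrow> L2_X_with T \<eta> \<eta>x \<Longrightarrow> cont_H T \<eta> \<Longrightarrow>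
           (AE x in lebesgue. x \<in> {0<..<1} \<longrightarrow> \<eta> T x = 0) \<Longrightarrow>
          - (LINT z:Qset T|lebesgue. h (unc v z) * unc \<eta>t z)
          + (LINT z:Qset T|lebesgue. (unc vx z + b (unc v z) * unc p z) * unc \<eta>x z)
          = (LINT x:{0<..<1}|lebesgue. h (v0 x) * \<eta> 0 x)"
    using sol unfolding weak_solution_def by blast
  have Lv: "L2_Q T v" and Lvx: "L2_Q T vx"
    and wd: "AE t in ?M. weak_deriv_on 0 1 (v t) (vx t)"
    using vx unfolding L2_X_with_def by (auto simp: AE_leb_on)
  obtain u where u [measurable]: "u \<in> borel_measurable borel" and vu: "AE z in leb_on (Qset T). unc v z = u z"
    using leb_on_borel_rep[OF Qset_borel, of T "unc v"] Lv unfolding L2_Q_def by blast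
  obtain ux where ux [measurable]: "ux \<in> borel_measurable borel" and vxux: "AE z in leb_on (Qset T). unc vx z = ux z"
    using leb_on_borel_rep[OF Qset_borel, of T "unc vx"] Lvx unfolding L2_Q_def by blast
  have [measurable]: "u \<in> borel_measurable (borel \<Otimes>\<^sub>M borel)" "ux \<in> borel_measurable (borel \<Otimes>\<^sub>M borel)"
    using u ux by (simp_all add: borel_prod)
  have Lu: "L2fun (leb_Q T) u" using L2_Q_iff[OF u vu] Lv by (simp add: leb_on_Qset)
  have Lux: "L2fun (leb_Q T) ux" using L2_Q_iff[OF ux vxux] Lvx by (simp add: leb_on_Qset)
  have "AE t in ?M. AE x in ?N. unc v (t, x) = u (t, x)"
    by (rule AE_pair) (use vu in \<open>simp only: leb_on_Qset\<close>)
  moreover have "AE t in ?M. AE x in ?N. unc vx (t, x) = ux (t, x)"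
    by (rule AE_pair) (use vxux in \<open>simp only: leb_on_Qset\<close>)
  ultimately have wdu: "AE t in ?M. weak_deriv_on 0 1 (\<lambda>x. u (t, x)) (\<lambda>x. ux (t, x))"
    using wd
  proof eventually_elim
    case (elim t)
    have m: "(\<lambda>x. u (t, x)) \<in> borel_measurable borel" "(\<lambda>x. ux (t, x)) \<in> borel_measurable borel" by measurable
    have ae: "AE x in ?N. v t x = u (t, x)" "AE x in ?N. vx t x = ux (t, x)"
      using elim(1,2) by (simp_all add: unc_def)
    show ?case using elim(3) weak_deriv_on_iff[OF m ae] weak_deriv_on_iff[OF m AE_I2 AE_I2, OF refl refl] by simp
  qed
  show ?thesis
  proof (rule that[OF Lu Lux vu wdu])
    fix \<theta> \<theta>x
    assume \<theta>: "L2fun (leb_Q T) \<theta>" and \<theta>x: "L2fun (leb_Q T) \<theta>x"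
      and wd\<theta>: "AE t in ?M. weak_deriv_on 0 1 (\<lambda>x. \<theta> (t, x)) (\<lambda>x. \<theta>x (t, x))"
    have [measurable]: "\<theta> \<in> borel_measurable borel" "int_after T \<theta>x \<in> borel_measurable borel"
      using L2fun_measurable[OF \<theta>] L2fun_measurable[OF L2fun_int_after[OF \<theta>x]] by (simp_all add: leb_on_Qset)
    have "(LINT z:Qset T|lebesgue. h (unc v z) * unc (\<lambda>t x. - \<theta> (t, x)) z) = (\<integral>z. - (h (u z) * \<theta> z) \<partial>leb_on (Qset T))"
      by (rule set_lebesgue_integral_leb_on) (simp, simp, use vu in eventually_elim, simp add: unc_def)
    moreover have "(LINT z:Qset T|lebesgue. (unc vx z + b (unc v z) * unc p z) * unc (\<lambda>t x. int_after T \<theta>x (t, x)) z)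
      = (\<integral>z. (ux z + b (u z) * p' z) * int_after T \<theta>x z \<partial>leb_on (Qset T))"
      by (rule set_lebesgue_integral_leb_on) (simp, simp, use vu vxux pp' in eventually_elim, simp add: unc_def)
    ultimately show "(\<integral>z. h (u z) * \<theta> z \<partial>leb_Q T) + (\<integral>z. (ux z + b (u z) * p' z) * int_after T \<theta>x z \<partial>leb_Q T)
       = (LINT x:{0<..<1}|lebesgue. h (v0 x) * int_after T \<theta> (0, x))"
      using test[OF int_after_weak_time_deriv[OF \<theta>] int_after_L2_X_with[OF \<theta> \<theta>x wd\<theta>] int_after_cont_H[OF \<theta>]]
      by (simp add: int_after_end leb_on_Qset)
  qed
qed

text \<open>\<open>P t\<close> is the squared H norm of a slice, and its square is integrable. On
  the finite interval (0,T) this makes \<open>P\<close> integrable, whence the representative of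
  \<open>p\<close> is square-integrable on Q.\<close>

lemma L4_H_borelE:
  assumes p: "L4_H T p"
  obtains p' where "L2fun (leb_Q T) p'" "AE z in leb_on (Qset T). unc p z = p' z"
    "integrable (leb_on {0<..<T}) (\<lambda>t. (\<integral>x. (p' (t, x))\<^sup>2 \<partial>leb_on {0<..<1})\<^sup>2)"
proof -
  let ?M = "leb_on {0<..<T}" and ?N = "leb_on {0<..<1::real}"
  interpret M: finite_measure ?M by (rule finite_measure_leb_on_interval)
  interpret N: finite_measure ?N by (rule finite_measure_leb_on_interval)
  interpret pair_sigma_finite ?M ?N by (rule finite_pair_sigma_finite) unfold_locales
  obtain q where q: "q \<in> borel_measurable borel" and pq: "AE z in leb_on (Qset T). unc p z = q z"
    using leb_on_borel_rep[OF Qset_borel, of T "unc p"] p unfolding L4_H_def by blast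
  have [measurable]: "q \<in> borel_measurable (borel \<Otimes>\<^sub>M borel)" using q by (simp add: borel_prod)
  define P where "P t = (\<integral>x. (q (t, x))\<^sup>2 \<partial>?N)" for t
  have [measurable]: "P \<in> borel_measurable borel" unfolding P_def by measurable
  have "AE t in ?M. AE x in ?N. unc p (t, x) = q (t, x)"
    by (rule AE_pair) (use pq in \<open>simp only: leb_on_Qset\<close>)
  moreover have "AE t in ?M. L2_int 0 1 (p t)" using p by (simp add: L4_H_def AE_leb_on)
  ultimately have ae: "AE t in ?M. L2fun ?N (\<lambda>x. q (t, x)) \<and> (LINT x:{0<..<1}|lebesgue. (p t x)\<^sup>2) = P t"
  proof eventually_elim
    case (elim t)
    have m [measurable]: "(\<lambda>x. q (t, x)) \<in> borel_measurable borel" by measurable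
    have ae: "AE x in ?N. p t x = q (t, x)" using elim(1) by (simp add: unc_def)
    have "(LINT x:{0<..<1}|lebesgue. (p t x)\<^sup>2) = P t"
      unfolding P_def by (rule set_lebesgue_integral_leb_on) (simp, simp, use ae in eventually_elim, simp)
    then show ?case using elim(2) L2_int_iff[OF m ae] by simp
  qed
  have P2: "integrable ?M (\<lambda>t. (P t)\<^sup>2)"
  proof (rule set_integrable_leb_on[THEN iffD1])
    show "set_integrable lebesgue {0<..<T} (\<lambda>t. (LINT x:{0<..<1}|lebesgue. (p t x)\<^sup>2)\<^sup>2)"
      using p by (simp add: L4_H_def)
    show "AE t in ?M. (LINT x:{0<..<1}|lebesgue. (p t x)\<^sup>2)\<^sup>2 = (P t)\<^sup>2"
      using ae by eventually_elim simp
  qed simp_all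
  then have "integrable ?M P" by (intro M.L2fun_integrable) (simp add: L2fun_def)
  then have "integrable (leb_Q T) (\<lambda>z. (q z)\<^sup>2)"
    by (intro Fubini_integrable) (use ae in \<open>auto simp: P_def[symmetric] L2fun_def elim!: eventually_mono\<close>)
  then have "L2fun (leb_Q T) q" using q by (simp add: L2fun_def leb_on_Qset)
  then show ?thesis using pq P2 unfolding P_def by (rule that)
qed

text \<open>The initial data have cancelled and the nonlinearities are hidden in \<open>w\<close>
  and \<open>R\<close>. Everything up to the energy identity is linear in this sense; h and b enter
  again only through the pointwise bounds assumed in \<open>V_eq_0\<close>.\<close>

locale weak_difference =
  fixes T :: real and V Vx w R :: "real \<times> real \<Rightarrow> real"
  assumes V: "L2fun (leb_Q T) V" and Vx: "L2fun (leb_Q T) Vx"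
    and w: "L2fun (leb_Q T) w" and R: "L2fun (leb_Q T) R"
    and wd: "AE t in leb_on {0<..<T}. weak_deriv_on 0 1 (\<lambda>x. V (t, x)) (\<lambda>x. Vx (t, x))"
    and eqn: "\<And>\<theta> \<theta>x. L2fun (leb_Q T) \<theta> \<Longrightarrow> L2fun (leb_Q T) \<theta>x \<Longrightarrow>
       AE t in leb_on {0<..<T}. weak_deriv_on 0 1 (\<lambda>x. \<theta> (t, x)) (\<lambda>x. \<theta>x (t, x)) \<Longrightarrow>
       (\<integral>z. w z * \<theta> z \<partial>leb_Q T) + (\<integral>z. (Vx z + R z) * int_after T \<theta>x z \<partial>leb_Q T) = 0"
begin

abbreviation "M \<equiv> leb_on {0<..<T}"
abbreviation "N \<equiv> leb_on {0<..<1::real}"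

sublocale M: finite_measure M by (rule finite_measure_leb_on_interval)
sublocale N: finite_measure N by (rule finite_measure_leb_on_interval)
sublocale pair_sigma_finite M N by (rule finite_pair_sigma_finite) unfold_locales

lemmas MN = M.finite_measure_axioms N.finite_measure_axioms

definition F :: "real \<times> real \<Rightarrow> real" where "F z = Vx z + R z"
definition G :: "real \<times> real \<Rightarrow> real" where "G = int_before T F"

lemma F: "L2fun (M \<Otimes>\<^sub>M N) F" unfolding F_def by (rule L2fun_add[OF Vx R])
lemma G: "L2fun (M \<Otimes>\<^sub>M N) G" unfolding G_def by (rule L2fun_int_before[OF F])

lemma meas [measurable]:
  "V \<in> borel_measurable (borel \<Otimes>\<^sub>M borel)" "Vx \<in> borel_measurable (borel \<Otimes>\<^sub>M borel)"
  "w \<in> borel_measurable (borel \<Otimes>\<^sub>M borel)" "R \<in> borel_measurable (borel \<Otimes>\<^sub>M borel)"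
  "F \<in> borel_measurable (borel \<Otimes>\<^sub>M borel)" "G \<in> borel_measurable (borel \<Otimes>\<^sub>M borel)"
  using L2fun_measurable[OF V] L2fun_measurable[OF Vx] L2fun_measurable[OF w] L2fun_measurable[OF R]
    L2fun_measurable[OF F] L2fun_measurable[OF G] by (simp_all add: leb_on_Qset borel_prod)

text \<open>The triangle swap takes the time primitive off \<open>\<theta>x\<close> and puts it on
  the flux, where it becomes \<open>G\<close>. The test functions are now general elements of
  L^2(0,T;X), with no regularity in time.\<close>

lemma eqn_G:
  assumes \<theta>: "L2fun (M \<Otimes>\<^sub>M N) \<theta>" and \<theta>x: "L2fun (M \<Otimes>\<^sub>M N) \<theta>x"
    and "AE t in M. weak_deriv_on 0 1 (\<lambda>x. \<theta> (t, x)) (\<lambda>x. \<theta>x (t, x))"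
  shows "(\<integral>z. w z * \<theta> z \<partial>(M \<Otimes>\<^sub>M N)) + (\<integral>z. \<theta>x z * G z \<partial>(M \<Otimes>\<^sub>M N)) = 0"
  using eqn[OF assms] triangle_swap_fst[OF MN _ F \<theta>x]
  by (simp add: F_def[symmetric] G_def int_after_def int_before_def)

text \<open>For \<theta> the primitive of \<open>\<theta>x\<close> from 0, the swap in space turns
  the integral of \<open>w * \<theta>\<close> into that of \<open>\<theta>x * W\<close>, so
  \<open>G + W\<close> is orthogonal to \<open>\<theta>x\<close>. Choosing \<open>\<theta>x\<close>
  to be \<open>g = G + W\<close> itself gives \<open>g = 0\<close>. The freedom of \<theta> at x = 1
  encodes the zero flux there.\<close>

lemma G_eq: "AE z in M \<Otimes>\<^sub>M N. G z = - (\<integral>y. indicator {snd z<..} y * w (fst z, y) \<partial>N)"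
proof -
  define W where "W z = (\<integral>y. indicator {snd z<..} y * w (fst z, y) \<partial>N)" for z
  have W: "L2fun (M \<Otimes>\<^sub>M N) W"
    using L2fun_kernel_snd[OF MN _ w, of "\<lambda>z. indicator {fst z<..} (snd z)"]
    by (simp add: W_def[abs_def] greaterThan_def indicator_def)
  define g where "g z = G z + W z" for z
  have g: "L2fun (M \<Otimes>\<^sub>M N) g" unfolding g_def by (rule L2fun_add[OF G W])
  define \<theta> where "\<theta> z = (\<integral>y. indicator {..<snd z} y * g (fst z, y) \<partial>N)" for z
  have \<theta>: "L2fun (M \<Otimes>\<^sub>M N) \<theta>"
    using L2fun_kernel_snd[OF MN _ g, of "\<lambda>z. indicator {..<fst z} (snd z)"]
    by (simp add: \<theta>_def[abs_def] lessThan_def indicator_def)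
  have "AE t in M. weak_deriv_on 0 1 (\<lambda>x. \<theta> (t, x)) (\<lambda>x. g (t, x))"
    using L2fun_slices(1)[OF MN g]
  proof eventually_elim
    case (elim t)
    show ?case unfolding \<theta>_def fst_conv snd_conv
      by (rule weak_deriv_on_indefinite_integral[OF N.L2fun_integrable[OF elim]])
  qed
  from eqn_G[OF \<theta> g this] have "(\<integral>z. g z * W z \<partial>(M \<Otimes>\<^sub>M N)) + (\<integral>z. g z * G z \<partial>(M \<Otimes>\<^sub>M N)) = 0"
    using triangle_swap_snd[OF MN _ w g] by (simp add: \<theta>_def W_def)
  moreover have "(\<integral>z. g z * W z \<partial>(M \<Otimes>\<^sub>M N)) + (\<integral>z. g z * G z \<partial>(M \<Otimes>\<^sub>M N)) = (\<integral>z. (g z)\<^sup>2 \<partial>(M \<Otimes>\<^sub>M N))"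
    by (subst Bochner_Integration.integral_add[symmetric])
       (use L2fun_mult_integrable[OF g W] L2fun_mult_integrable[OF g G] in
         \<open>auto simp: g_def power2_eq_square algebra_simps\<close>)
  ultimately have "(\<integral>z. (g z)\<^sup>2 \<partial>(M \<Otimes>\<^sub>M N)) = 0" by simp
  then have "AE z in M \<Otimes>\<^sub>M N. (g z)\<^sup>2 = 0"
    using integral_nonneg_eq_0_iff_AE[OF L2fun_square[OF g]] by simp
  then show ?thesis by eventually_elim (simp add: g_def W_def)
qed

text \<open>The cut-off depends on time alone and so respects the weak space derivative. After
  substituting \<open>Vx = F - R\<close>, the term \<open>F * G\<close> is half a time derivative of
  \<open>G\<^sup>2\<close>, integrated exactly by \<open>triangle_square\<close>. As
  \<open>G\<close> is a concrete integral and not a class of functions, the identity holds for every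
  real \<tau>, which the Gronwall lemma requires.\<close>

lemma energy:
  "(\<integral>z. indicator {..<\<tau>} (fst z) * (w z * V z) \<partial>(M \<Otimes>\<^sub>M N)) + (\<integral>x. (G (\<tau>, x))\<^sup>2 \<partial>N) / 2
   = (\<integral>z. indicator {..<\<tau>} (fst z) * (R z * G z) \<partial>(M \<Otimes>\<^sub>M N))"
proof -
  define i where "i z = indicat_real {..<\<tau>} (fst z)" for z :: "real \<times> real"
  have im [measurable]: "i \<in> borel_measurable (borel \<Otimes>\<^sub>M borel)" unfolding i_def by measurable
  have i1: "\<bar>i z\<bar> \<le> 1" for z by (auto simp: i_def indicator_def)
  have L: "L2fun (M \<Otimes>\<^sub>M N) (\<lambda>z. i z * f z)" if "L2fun (M \<Otimes>\<^sub>M N) f" for f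
    by (rule L2fun_bounded_mult[OF that _ i1]) measurable
  have wdi: "AE t in M. weak_deriv_on 0 1 (\<lambda>x. i (t, x) * V (t, x)) (\<lambda>x. i (t, x) * Vx (t, x))"
    using wd
  proof eventually_elim
    case (elim t)
    show ?case using elim by (cases "t < \<tau>") (simp_all add: i_def weak_deriv_on_def)
  qed
  have "(\<integral>z. w z * (i z * V z) \<partial>(M \<Otimes>\<^sub>M N)) + (\<integral>z. i z * Vx z * G z \<partial>(M \<Otimes>\<^sub>M N)) = 0"
    by (rule eqn_G[OF L[OF V] L[OF Vx] wdi])
  moreover have "(\<integral>z. i z * Vx z * G z \<partial>(M \<Otimes>\<^sub>M N))
      = (\<integral>z. i z * F z * G z \<partial>(M \<Otimes>\<^sub>M N)) - (\<integral>z. i z * R z * G z \<partial>(M \<Otimes>\<^sub>M N))"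
    by (subst Bochner_Integration.integral_diff[symmetric])
       (use L2fun_mult_integrable[OF L[OF F] G] L2fun_mult_integrable[OF L[OF R] G] in
         \<open>auto simp: F_def algebra_simps\<close>)
  moreover have "(\<integral>z. i z * F z * G z \<partial>(M \<Otimes>\<^sub>M N)) = (\<integral>x. (G (\<tau>, x))\<^sup>2 / 2 \<partial>N)"
  proof -
    have "(\<integral>z. i z * F z * G z \<partial>(M \<Otimes>\<^sub>M N)) = (\<integral>x. (\<integral>t. i (t, x) * F (t, x) * G (t, x) \<partial>M) \<partial>N)"
      using L2fun_mult_integrable[OF L[OF F] G] by (subst integral_snd) (simp_all add: case_prod_beta')
    also have "\<dots> = (\<integral>x. (G (\<tau>, x))\<^sup>2 / 2 \<partial>N)"
    proof (intro integral_cong_AE)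
      show "AE x in N. (\<integral>t. i (t, x) * F (t, x) * G (t, x) \<partial>M) = (G (\<tau>, x))\<^sup>2 / 2"
        using L2fun_slices(2)[OF MN L[OF F]]
      proof eventually_elim
        case (elim x)
        let ?f = "\<lambda>t. i (t, x) * F (t, x)"
        have "(\<integral>t. ?f t * G (t, x) \<partial>M) = (\<integral>t. ?f t * (\<integral>s. indicator {..<t} s * ?f s \<partial>M) \<partial>M)"
        proof (intro Bochner_Integration.integral_cong refl)
          fix t
          \<comment> \<open>For \<open>t < \<tau>\<close> the integral defining \<open>G\<close>
            sees only times at which the cut-off is 1; for other \<open>t\<close> the outer factor
            is 0.\<close>
          have "G (t, x) = (\<integral>s. indicator {..<t} s * ?f s \<partial>M)" if "t < \<tau>"
            unfolding G_def int_before_def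
            by (intro Bochner_Integration.integral_cong) (use that in \<open>auto simp: i_def indicator_def\<close>)
          then show "?f t * G (t, x) = ?f t * (\<integral>s. indicator {..<t} s * ?f s \<partial>M)"
            by (cases "t < \<tau>") (auto simp: i_def)
        qed
        also have "\<dots> = (\<integral>t. ?f t \<partial>M)\<^sup>2 / 2"
          by (rule triangle_square(1)[OF MN(1) _ M.L2fun_integrable[OF elim] no_atoms_leb_on]) simp
        also have "(\<integral>t. ?f t \<partial>M) = G (\<tau>, x)" by (simp add: G_def int_before_def i_def)
        finally show ?case .
      qed
    qed measurable
    finally show ?thesis .
  qed
  ultimately show ?thesis by (simp add: i_def mult_ac)
qed

text \<open>The gain \<open>\<delta> * (V z)\<^sup>2\<close> from monotonicity cancels the
  \<open>V\<close> term of \<open>slice_estimate\<close>, applied with the same \<delta>, and an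
  inequality for \<open>A\<close> alone remains.\<close>

lemma V_eq_0:
  fixes p :: "real \<times> real \<Rightarrow> real"
  assumes p: "L2fun (M \<Otimes>\<^sub>M N) p" and P2: "integrable M (\<lambda>t. (\<integral>x. (p (t, x))\<^sup>2 \<partial>N)\<^sup>2)"
    and wV: "\<And>z. \<bar>w z\<bar> \<le> Ch * \<bar>V z\<bar>" and RV: "\<And>z. \<bar>R z\<bar> \<le> Cb * \<bar>V z\<bar> * \<bar>p z\<bar>"
    and mono: "\<And>z. \<delta> * (V z)\<^sup>2 \<le> w z * V z"
    and pos: "\<delta> > 0" "Ch > 0" "Cb > 0"
  shows "AE z in M \<Otimes>\<^sub>M N. V z = 0"
proof -
  have [measurable]: "p \<in> borel_measurable (borel \<Otimes>\<^sub>M borel)"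
    using L2fun_measurable[OF p] by (simp add: leb_on_Qset borel_prod)
  define P where "P t = (\<integral>x. (p (t, x))\<^sup>2 \<partial>N)" for t
  define A where "A t = (\<integral>x. (G (t, x))\<^sup>2 \<partial>N)" for t
  define K where "K = Cb^4 * Ch\<^sup>2 / (2 * \<delta>^3)"
  define C where "C = measure M UNIV * (\<integral>z. (F z)\<^sup>2 \<partial>(M \<Otimes>\<^sub>M N))"
  have [measurable]: "A \<in> borel_measurable borel" "P \<in> borel_measurable borel"
    unfolding A_def P_def by measurable
  have K: "K \<ge> 0" using pos by (simp add: K_def)
  have A0: "A t \<ge> 0" for t by (simp add: A_def)
  \<comment> \<open>A bound at every time, by Cauchy-Schwarz in time; the Gronwall lemma takes a
    supremum of \<open>A\<close>.\<close>
  have AC: "A t \<le> C" for t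
  proof -
    have "A t \<le> measure M {..<t} * (\<integral>z. (F z)\<^sup>2 \<partial>(M \<Otimes>\<^sub>M N))"
      unfolding A_def G_def int_before_def fst_conv snd_conv by (rule time_integral_L2(2)[OF F]) simp
    also have "\<dots> \<le> C" unfolding C_def by (intro mult_right_mono M.finite_measure_mono) auto
    finally show ?thesis .
  qed
  have iPA: "integrable M (\<lambda>t. (P t)\<^sup>2 * A t)"
    by (rule Bochner_Integration.integrable_bound[OF integrable_mult_left[OF P2, of C]])
       (auto simp: P_def[symmetric] A0 abs_mult intro!: mult_left_mono order_trans[OF AC abs_ge_self])
  have iV: "integrable (M \<Otimes>\<^sub>M N) (\<lambda>z. (V z)\<^sup>2)" by (rule L2fun_square[OF V])
  have iwV: "integrable (M \<Otimes>\<^sub>M N) (\<lambda>z. w z * V z)" by (rule L2fun_mult_integrable[OF w V])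
  have iRG: "integrable (M \<Otimes>\<^sub>M N) (\<lambda>z. R z * G z)" by (rule L2fun_mult_integrable[OF R G])
  have iRG': "integrable (M \<Otimes>\<^sub>M N) (\<lambda>z. \<bar>R z * G z\<bar> - \<delta> * (V z)\<^sup>2)" using iRG iV by auto
  have "AE t in M. AE y in N. G (t, y) = - (\<integral>x. indicator {y<..} x * w (t, x) \<partial>N)"
    using AE_pair[OF G_eq] by simp
  then have slice: "AE t in M. (\<integral>x. \<bar>R (t, x) * G (t, x)\<bar> - \<delta> * (V (t, x))\<^sup>2 \<partial>N) \<le> K * ((P t)\<^sup>2 * A t)"
    using L2fun_slices(1)[OF MN w] L2fun_slices(1)[OF MN G] L2fun_slices(1)[OF MN V] L2fun_slices(1)[OF MN p]
  proof eventually_elim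
    case (elim t)
    have "(\<lambda>x. R (t, x)) \<in> borel_measurable borel" by measurable
    note s = slice_estimate[OF elim(2-5) this elim(1) wV RV pos]
    have "(\<integral>x. \<bar>R (t, x) * G (t, x)\<bar> - \<delta> * (V (t, x))\<^sup>2 \<partial>N)
      = (\<integral>x. \<bar>R (t, x) * G (t, x)\<bar> \<partial>N) - \<delta> * (\<integral>x. (V (t, x))\<^sup>2 \<partial>N)"
      using s(1) L2fun_square[OF elim(4)] by simp
    also have "\<dots> \<le> K * ((P t)\<^sup>2 * A t)" using s(2) by (simp add: K_def P_def A_def)
    finally show ?case .
  qed
  have ind: "integrable (M \<Otimes>\<^sub>M N) (\<lambda>z. indicator {..<\<tau>} (fst z) * f z)"
    if "integrable (M \<Otimes>\<^sub>M N) f" for f :: "real \<times> real \<Rightarrow> real" and \<tau>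
  proof -
    have [measurable]: "f \<in> borel_measurable (M \<Otimes>\<^sub>M N)" using that by simp
    show ?thesis by (rule Bochner_Integration.integrable_bound[OF that]) (auto simp: indicator_def)
  qed
  \<comment> \<open>The factor 2 undoes the 1/2 in the energy identity. The weight
    \<open>2 * K * (P t)\<^sup>2\<close> is integrable exactly by the L^4 assumption on
    \<open>p\<close>.\<close>
  have gron: "A \<tau> \<le> (\<integral>t. indicator {..<\<tau>} t * ((2 * K * (P t)\<^sup>2) * A t) \<partial>M)" for \<tau>
  proof -
    have "A \<tau> / 2 = (\<integral>z. indicator {..<\<tau>} (fst z) * (R z * G z) \<partial>(M \<Otimes>\<^sub>M N))
       - (\<integral>z. indicator {..<\<tau>} (fst z) * (w z * V z) \<partial>(M \<Otimes>\<^sub>M N))"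
      using energy[of \<tau>] by (simp add: A_def)
    also have "\<dots> = (\<integral>z. indicator {..<\<tau>} (fst z) * (R z * G z) - indicator {..<\<tau>} (fst z) * (w z * V z) \<partial>(M \<Otimes>\<^sub>M N))"
      using ind[OF iRG] ind[OF iwV] by simp
    also have "\<dots> \<le> (\<integral>z. indicator {..<\<tau>} (fst z) * (\<bar>R z * G z\<bar> - \<delta> * (V z)\<^sup>2) \<partial>(M \<Otimes>\<^sub>M N))"
    proof (rule integral_mono)
      show "integrable (M \<Otimes>\<^sub>M N) (\<lambda>z. indicator {..<\<tau>} (fst z) * (R z * G z) - indicator {..<\<tau>} (fst z) * (w z * V z))"
        using ind[OF iRG] ind[OF iwV] by auto
      show "integrable (M \<Otimes>\<^sub>M N) (\<lambda>z. indicator {..<\<tau>} (fst z) * (\<bar>R z * G z\<bar> - \<delta> * (V z)\<^sup>2))"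
        by (rule ind[OF iRG'])
      fix z
      have "R z * G z - w z * V z \<le> \<bar>R z * G z\<bar> - \<delta> * (V z)\<^sup>2" using mono[of z] abs_ge_self[of "R z * G z"] by linarith
      then show "indicator {..<\<tau>} (fst z) * (R z * G z) - indicator {..<\<tau>} (fst z) * (w z * V z)
        \<le> indicator {..<\<tau>} (fst z) * (\<bar>R z * G z\<bar> - \<delta> * (V z)\<^sup>2)" by (simp add: indicator_def)
    qed
    also have "\<dots> = (\<integral>t. indicator {..<\<tau>} t * (\<integral>x. \<bar>R (t, x) * G (t, x)\<bar> - \<delta> * (V (t, x))\<^sup>2 \<partial>N) \<partial>M)"
      using integral_fst'[OF ind[OF iRG', of \<tau>]] by simp
    also have "\<dots> \<le> (\<integral>t. indicator {..<\<tau>} t * (K * ((P t)\<^sup>2 * A t)) \<partial>M)"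
    proof (rule integral_mono_AE)
      show "integrable M (\<lambda>t. indicator {..<\<tau>} t * (\<integral>x. \<bar>R (t, x) * G (t, x)\<bar> - \<delta> * (V (t, x))\<^sup>2 \<partial>N))"
        using integrable_fst'[OF ind[OF iRG', of \<tau>]] by simp
      show "integrable M (\<lambda>t. indicator {..<\<tau>} t * (K * ((P t)\<^sup>2 * A t)))"
        by (rule Bochner_Integration.integrable_bound[OF integrable_mult_right[OF iPA, of K]])
           (auto simp: indicator_def)
      show "AE t in M. indicator {..<\<tau>} t * (\<integral>x. \<bar>R (t, x) * G (t, x)\<bar> - \<delta> * (V (t, x))\<^sup>2 \<partial>N)
         \<le> indicator {..<\<tau>} t * (K * ((P t)\<^sup>2 * A t))"
        using slice by eventually_elim (simp add: indicator_def)
    qed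
    finally have "A \<tau> \<le> 2 * (\<integral>t. indicator {..<\<tau>} t * (K * ((P t)\<^sup>2 * A t)) \<partial>M)" by simp
    also have "\<dots> = (\<integral>t. 2 * (indicator {..<\<tau>} t * (K * ((P t)\<^sup>2 * A t))) \<partial>M)" by simp
    finally show ?thesis by (simp add: mult_ac)
  qed
  have Az: "A t = 0" for t
    by (rule Gronwall_leb_on[OF _ _ _ A0 AC gron]) (use P2 K in \<open>auto simp: P_def\<close>)
  have "(\<integral>z. (G z)\<^sup>2 \<partial>(M \<Otimes>\<^sub>M N)) = (\<integral>t. A t \<partial>M)"
    using integral_fst'[OF L2fun_square[OF G]] by (simp add: A_def)
  then have "AE z in M \<Otimes>\<^sub>M N. (G z)\<^sup>2 = 0"
    using integral_nonneg_eq_0_iff_AE[OF L2fun_square[OF G]] by (simp add: Az)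
  \<comment> \<open>With \<open>G = 0\<close> the other two terms of the energy identity vanish;
    \<tau> = T is taken because the cut-off is then 1 on all of Q.\<close>
  then have "(\<integral>z. indicator {..<T} (fst z) * (R z * G z) \<partial>(M \<Otimes>\<^sub>M N)) = 0"
    by (intro integral_eq_zero_AE) (auto elim!: eventually_mono)
  then have "(\<integral>z. indicator {..<T} (fst z) * (w z * V z) \<partial>(M \<Otimes>\<^sub>M N)) = 0"
    using energy[of T] Az[of T] by (simp add: A_def)
  moreover have "0 \<le> w z * V z" for z
    using mono[of z] pos(1) by (meson order_trans mult_nonneg_nonneg less_imp_le zero_le_power2)
  ultimately have "AE z in M \<Otimes>\<^sub>M N. indicator {..<T} (fst z) * (w z * V z) = 0"
    using integral_nonneg_eq_0_iff_AE[OF ind[OF iwV, of T]] by simp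
  moreover have "AE z in M \<Otimes>\<^sub>M N. z \<in> Qset T" unfolding leb_on_Qset by (rule AE_leb_on_mem[OF Qset_borel])
  ultimately show ?thesis
  proof eventually_elim
    case (elim z)
    then have "w z * V z = 0" by (auto simp: Qset_def)
    with mono[of z] have "\<delta> * (V z)\<^sup>2 \<le> 0" by (rule ord_le_eq_trans)
    then show ?case using pos(1) by (simp add: mult_le_0_iff)
  qed
qed

end

section \<open>Uniqueness\<close>

lemma differentiable_mvt:
  fixes f :: "real \<Rightarrow> real"
  assumes "\<And>x. f differentiable (at x)"
  obtains \<xi> where "f x - f y = deriv f \<xi> * (x - y)"
proof -
  have D: "(f has_real_derivative deriv f x) (at x)" for x
    using assms by (simp add: DERIV_deriv_iff_real_differentiable)
  consider "x < y" | "x = y" | "y < x" by linarith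
  then show ?thesis
  proof cases
    case 1
    then obtain \<xi> where "f y - f x = (y - x) * deriv f \<xi>" using MVT2[OF 1, of f "deriv f"] D by blast
    then show ?thesis by (intro that[of \<xi>]) (simp add: algebra_simps)
  next
    case 3
    then obtain \<xi> where "f x - f y = (x - y) * deriv f \<xi>" using MVT2[OF 3, of f "deriv f"] D by blast
    then show ?thesis by (intro that[of \<xi>]) (simp add: algebra_simps)
  qed (use that in simp)
qed

lemma C2_fun_measurable: "C2_fun f \<Longrightarrow> f \<in> borel_measurable borel"
  unfolding C2_fun_def
  by (intro borel_measurable_continuous_onI continuous_at_imp_continuous_on)
     (auto intro: differentiable_imp_continuous_within)

lemma C2_fun_Lipschitz:
  assumes "C2_fun f" "\<And>x. \<bar>deriv f x\<bar> \<le> C"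
  shows "\<bar>f x - f y\<bar> \<le> C * \<bar>x - y\<bar>"
proof -
  obtain \<xi> where "f x - f y = deriv f \<xi> * (x - y)"
    using differentiable_mvt[of f x y] assms(1) unfolding C2_fun_def by blast
  then show ?thesis using assms(2)[of \<xi>] by (auto simp: abs_mult intro!: mult_right_mono)
qed

text \<open>Both estimates come from the mean value theorem: the upper bound on h' gives the
  Lipschitz constant, the lower bound the constant of strong monotonicity.\<close>

lemma assm_A1E:
  assumes "assm_A1 h"
  obtains \<delta> C where "\<delta> > 0" "C > 0" "\<And>x y. \<bar>h x - h y\<bar> \<le> C * \<bar>x - y\<bar>"
    "\<And>x y. \<delta> * (x - y)\<^sup>2 \<le> (h x - h y) * (x - y)"
proof -
  obtain \<delta> C where C2: "C2_fun h" and pos: "\<delta> > 0" "C > 0" and h: "\<And>x. \<delta> \<le> deriv h x" "\<And>x. deriv h x \<le> C"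
    using assms unfolding assm_A1_def by blast
  have "\<bar>deriv h x\<bar> \<le> C" for x using h[of x] pos by auto
  with C2 have 1: "\<bar>h x - h y\<bar> \<le> C * \<bar>x - y\<bar>" for x y by (rule C2_fun_Lipschitz)
  have 2: "\<delta> * (x - y)\<^sup>2 \<le> (h x - h y) * (x - y)" for x y
  proof -
    obtain \<xi> where "h x - h y = deriv h \<xi> * (x - y)"
      using differentiable_mvt[of h x y] C2 unfolding C2_fun_def by blast
    then have "(h x - h y) * (x - y) = deriv h \<xi> * (x - y)\<^sup>2" by (simp add: power2_eq_square)
    then show ?thesis using h(1)[of \<xi>] by (simp add: mult_right_mono)
  qed
  show ?thesis by (rule that[OF pos 1 2])
qed

lemma weak_deriv_on_diff:
  assumes [measurable]: "f \<in> borel_measurable borel" "g \<in> borel_measurable borel"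
     "f' \<in> borel_measurable borel" "g' \<in> borel_measurable borel"
    and "weak_deriv_on a b f f'" "weak_deriv_on a b g g'"
  shows "weak_deriv_on a b (\<lambda>x. f x - g x) (\<lambda>x. f' x - g' x)"
proof -
  let ?N = "leb_on {a<..<b}"
  note iff = weak_deriv_on_iff[OF _ _ AE_I2 AE_I2, OF _ _ refl refl]
  have f: "integrable ?N f" "integrable ?N f'" and g: "integrable ?N g" "integrable ?N g'"
    and ff': "\<And>\<phi>. test_fun a b \<phi> \<Longrightarrow> (\<integral>x. f x * deriv \<phi> x \<partial>?N) = - (\<integral>x. f' x * \<phi> x \<partial>?N)"
    and gg': "\<And>\<phi>. test_fun a b \<phi> \<Longrightarrow> (\<integral>x. g x * deriv \<phi> x \<partial>?N) = - (\<integral>x. g' x * \<phi> x \<partial>?N)"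
    using assms(5,6) by (simp_all add: iff)
  have "(\<integral>x. (f x - g x) * deriv \<phi> x \<partial>?N) = - (\<integral>x. (f' x - g' x) * \<phi> x \<partial>?N)" if \<phi>: "test_fun a b \<phi>" for \<phi>
  proof -
    have [measurable]: "\<phi> \<in> borel_measurable borel" "deriv \<phi> \<in> borel_measurable borel"
      by (rule test_fun_measurable[OF \<phi>])+
    obtain C where C: "\<And>x. \<bar>\<phi> x\<bar> \<le> C" "\<And>x. \<bar>deriv \<phi> x\<bar> \<le> C" using test_fun_bounded[OF \<phi>] by blast
    have i: "integrable ?N (\<lambda>x. k x * l x)" if k: "integrable ?N k" and [measurable]: "l \<in> borel_measurable borel"
      and l: "\<And>x. \<bar>l x\<bar> \<le> C" for k l :: "real \<Rightarrow> real"
    proof -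
      have [measurable]: "k \<in> borel_measurable borel" using borel_measurable_integrable[OF k] by simp
      show ?thesis
        by (rule Bochner_Integration.integrable_bound[OF integrable_mult_left[OF k, of C]])
           (auto simp: abs_mult intro!: mult_left_mono order_trans[OF l abs_ge_self])
    qed
    show ?thesis
      using ff'[OF \<phi>] gg'[OF \<phi>] f g C by (simp add: left_diff_distrib i)
  qed
  with f g show ?thesis by (simp add: iff)
qed

theorem theorem2p3:
  fixes h b :: "real \<Rightarrow> real" and T :: real
    and p v1 v2 :: "real \<Rightarrow> real \<Rightarrow> real" and v0 :: "real \<Rightarrow> real"
  assumes "T > 0" and "assm_A1 h" and "assm_A2 b"
    and "L4_H T p" and "L2_int 0 1 v0"
    and "weak_solution h b T p v0 v1" and "weak_solution h b T p v0 v2"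
  shows "AE z in lebesgue. z \<in> Qset T \<longrightarrow> v1 (fst z) (snd z) = v2 (fst z) (snd z)"
proof -
  obtain \<delta> Ch where \<delta>: "\<delta> > 0" and Ch: "Ch > 0" and hL: "\<And>x y. \<bar>h x - h y\<bar> \<le> Ch * \<bar>x - y\<bar>"
    and hm: "\<And>x y. \<delta> * (x - y)\<^sup>2 \<le> (h x - h y) * (x - y)"
    using assm_A1E[OF assms(2)] by blast
  \<comment> \<open>The one constant of (A2) bounds b, which keeps \<open>b (u z) * q z\<close>
    square-integrable, and b', which makes b Lipschitz and controls \<open>?R\<close> by
    \<open>?V\<close> times \<open>q\<close>.\<close>
  obtain Cb where Cb: "Cb > 0" and b: "C2_fun b" "\<And>x. 0 < b x \<and> b x \<le> Cb" "\<And>x. \<bar>deriv b x\<bar> \<le> Cb"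
    using assms(3) unfolding assm_A2_def by (metis less_le_trans)
  have bL: "\<bar>b x - b y\<bar> \<le> Cb * \<bar>x - y\<bar>" for x y by (rule C2_fun_Lipschitz[OF b(1,3)])
  have bB: "\<bar>b x\<bar> \<le> Cb" for x using b(2)[of x] by simp
  have hb [measurable]: "h \<in> borel_measurable borel" "b \<in> borel_measurable borel"
    using C2_fun_measurable assms(2) b(1) by (auto simp: assm_A1_def)
  obtain q where q: "L2fun (leb_Q T) q" and pq: "AE z in leb_on (Qset T). unc p z = q z"
    and P2: "integrable (leb_on {0<..<T}) (\<lambda>t. (\<integral>x. (q (t, x))\<^sup>2 \<partial>leb_on {0<..<1})\<^sup>2)"
    using L4_H_borelE[OF assms(4)] by blast
  have qm: "q \<in> borel_measurable borel" using L2fun_measurable[OF q] by (simp add: leb_on_Qset)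
  from weak_solution_borelE[OF assms(6) hb qm pq]
  obtain u1 u1x where u1: "L2fun (leb_Q T) u1" "L2fun (leb_Q T) u1x" "AE z in leb_on (Qset T). unc v1 z = u1 z"
    "AE t in leb_on {0<..<T}. weak_deriv_on 0 1 (\<lambda>x. u1 (t, x)) (\<lambda>x. u1x (t, x))"
    and eq1: "\<And>\<theta> \<theta>x. L2fun (leb_Q T) \<theta> \<Longrightarrow> L2fun (leb_Q T) \<theta>x \<Longrightarrow>
       AE t in leb_on {0<..<T}. weak_deriv_on 0 1 (\<lambda>x. \<theta> (t, x)) (\<lambda>x. \<theta>x (t, x)) \<Longrightarrow>
       (\<integral>z. h (u1 z) * \<theta> z \<partial>leb_Q T) + (\<integral>z. (u1x z + b (u1 z) * q z) * int_after T \<theta>x z \<partial>leb_Q T)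
       = (LINT x:{0<..<1}|lebesgue. h (v0 x) * int_after T \<theta> (0, x))" by blast
  from weak_solution_borelE[OF assms(7) hb qm pq]
  obtain u2 u2x where u2: "L2fun (leb_Q T) u2" "L2fun (leb_Q T) u2x" "AE z in leb_on (Qset T). unc v2 z = u2 z"
    "AE t in leb_on {0<..<T}. weak_deriv_on 0 1 (\<lambda>x. u2 (t, x)) (\<lambda>x. u2x (t, x))"
    and eq2: "\<And>\<theta> \<theta>x. L2fun (leb_Q T) \<theta> \<Longrightarrow> L2fun (leb_Q T) \<theta>x \<Longrightarrow>
       AE t in leb_on {0<..<T}. weak_deriv_on 0 1 (\<lambda>x. \<theta> (t, x)) (\<lambda>x. \<theta>x (t, x)) \<Longrightarrow>
       (\<integral>z. h (u2 z) * \<theta> z \<partial>leb_Q T) + (\<integral>z. (u2x z + b (u2 z) * q z) * int_after T \<theta>x z \<partial>leb_Q T)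
       = (LINT x:{0<..<1}|lebesgue. h (v0 x) * int_after T \<theta> (0, x))" by blast
  note [measurable] = L2fun_measurable[OF u1(1)] L2fun_measurable[OF u1(2)]
    L2fun_measurable[OF u2(1)] L2fun_measurable[OF u2(2)] L2fun_measurable[OF q]
  \<comment> \<open>h grows at most linearly: \<open>h (u z) - h 0\<close> is controlled by
    \<open>u\<close>, and the constant \<open>h 0\<close> is square-integrable because Q has finite
    measure.\<close>
  have Lh: "L2fun (leb_Q T) (\<lambda>z. h (u z))" if u: "L2fun (leb_Q T) u" for u
  proof -
    note [measurable] = L2fun_measurable[OF u]
    have "L2fun (leb_Q T) (\<lambda>z. h (u z) - h 0)"
      by (rule L2fun_bound[OF u, of _ Ch]) (use hL[of _ 0] in auto)
    from L2fun_add[OF this finite_measure.L2fun_const[OF finite_measure_leb_Q, of _ "h 0"]]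
    show ?thesis by simp
  qed
  have Lb: "L2fun (leb_Q T) (\<lambda>z. b (u z) * q z)" if u: "L2fun (leb_Q T) u" for u
  proof -
    note [measurable] = L2fun_measurable[OF u]
    show ?thesis by (rule L2fun_bounded_mult[OF q _ bB]) measurable
  qed
  let ?V = "\<lambda>z. u1 z - u2 z" and ?Vx = "\<lambda>z. u1x z - u2x z"
    and ?w = "\<lambda>z. h (u1 z) - h (u2 z)" and ?R = "\<lambda>z. b (u1 z) * q z - b (u2 z) * q z"
  interpret weak_difference T ?V ?Vx ?w ?R
  proof
    show "L2fun (leb_Q T) ?V" "L2fun (leb_Q T) ?Vx" "L2fun (leb_Q T) ?w" "L2fun (leb_Q T) ?R"
      by (intro L2fun_diff Lh Lb u1 u2)+
    show "AE t in leb_on {0<..<T}. weak_deriv_on 0 1 (\<lambda>x. ?V (t, x)) (\<lambda>x. ?Vx (t, x))"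
      using u1(4) u2(4)
    proof eventually_elim
      case (elim t)
      show ?case by (rule weak_deriv_on_diff[OF _ _ _ _ elim]) measurable
    qed
    fix \<theta> \<theta>x
    assume \<theta>: "L2fun (leb_Q T) \<theta>" "L2fun (leb_Q T) \<theta>x"
       "AE t in leb_on {0<..<T}. weak_deriv_on 0 1 (\<lambda>x. \<theta> (t, x)) (\<lambda>x. \<theta>x (t, x))"
    let ?I = "int_after T \<theta>x"
    have I: "L2fun (leb_Q T) ?I" by (rule L2fun_int_after[OF \<theta>(2)])
    have diff: "(\<integral>z. (f z - g z) * k z \<partial>leb_Q T) = (\<integral>z. f z * k z \<partial>leb_Q T) - (\<integral>z. g z * k z \<partial>leb_Q T)"
      if "L2fun (leb_Q T) f" "L2fun (leb_Q T) g" "L2fun (leb_Q T) k" for f g k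
      using L2fun_mult_integrable[OF that(1,3)] L2fun_mult_integrable[OF that(2,3)]
      by (simp add: left_diff_distrib)
    have 1: "(\<integral>z. ?w z * \<theta> z \<partial>leb_Q T) = (\<integral>z. h (u1 z) * \<theta> z \<partial>leb_Q T) - (\<integral>z. h (u2 z) * \<theta> z \<partial>leb_Q T)"
      by (intro diff Lh u1 u2 \<theta>)
    have "(\<integral>z. (?Vx z + ?R z) * ?I z \<partial>leb_Q T)
      = (\<integral>z. ((u1x z + b (u1 z) * q z) - (u2x z + b (u2 z) * q z)) * ?I z \<partial>leb_Q T)"
      by (simp add: algebra_simps)
    also have "\<dots> = (\<integral>z. (u1x z + b (u1 z) * q z) * ?I z \<partial>leb_Q T) - (\<integral>z. (u2x z + b (u2 z) * q z) * ?I z \<partial>leb_Q T)"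
      by (intro diff L2fun_add Lb u1 u2 I)
    finally have 2: "(\<integral>z. (?Vx z + ?R z) * ?I z \<partial>leb_Q T) = \<dots>" .
    show "(\<integral>z. ?w z * \<theta> z \<partial>leb_Q T) + (\<integral>z. (?Vx z + ?R z) * ?I z \<partial>leb_Q T) = 0"
      unfolding 1 2 using eq1[OF \<theta>] eq2[OF \<theta>] by simp
  qed
  have "AE z in leb_Q T. ?V z = 0"
  proof (rule V_eq_0[OF q P2 _ _ _ \<delta> Ch Cb])
    fix z
    show "\<bar>?w z\<bar> \<le> Ch * \<bar>?V z\<bar>" by (rule hL)
    show "\<delta> * (?V z)\<^sup>2 \<le> ?w z * ?V z" by (rule hm)
    show "\<bar>?R z\<bar> \<le> Cb * \<bar>?V z\<bar> * \<bar>q z\<bar>"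
      unfolding left_diff_distrib[symmetric] abs_mult by (rule mult_right_mono[OF bL]) simp
  qed
  then have "AE z in leb_on (Qset T). ?V z = 0" unfolding leb_on_Qset .
  with u1(3) u2(3) have "AE z in leb_on (Qset T). unc v1 z = unc v2 z"
    by eventually_elim simp
  then show ?thesis by (simp add: AE_leb_on unc_def)
qed

end
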